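(* Let $\Delta\subseteq M_{\mathbb R}$ be a full-dimensional lattice polyhedron, $\Sigma=\mathcal N(\Delta)$, $X=\mathbb P(\Delta)$, and let $\Delta^+\subseteq\Delta^-$ be lattice polyhedra in $\mathrm{Pol}^+(\Sigma)$ such that $\Delta^-\setminus\Delta^+$ has exactly two connected components $C_0,C_1$. Put $\nabla_i:=C_i\cup\Delta^+$ ($i=0,1$) and assume $\nabla_0,\nabla_1\in\mathrm{Pol}^+(\Sigma)$. Then under the identification $\mathrm{Ext}^1\big(\mathcal O_X(\Delta^-),\mathcal O_X(\Delta^+)\big)_0=\widetilde H^0(\Delta^-\setminus\Delta^+,\mathbb C)$, the $T$-equivariant exact sequence $$0\to\mathcal O_X(\Delta^+)\xrightarrow{\binom{-1}{1}}\mathcal O_X(\nabla_0)\oplus\mathcal O_X(\nabla_1)\xrightarrow{(1\ 1)}\mathcal O_X(\Delta^-)\to0$$ corresponds to the class $[C_1]\in\widetilde H^0(\Delta^-\setminus\Delta^+,\mathbb C)$, which is equal to $-[C_0]$.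
   Context: $M$ is a lattice of finite rank, $N$ its dual, $T=\mathrm{Spec}\,\mathbb C[M]$ with characters $\chi^m$. A polyhedron is a finite intersection of closed half-spaces in $M_{\mathbb R}$, always assumed to have at least one vertex; a lattice polyhedron has its vertices in $M$. For a full-dimensional lattice polyhedron $\Delta$, $\mathcal N(\Delta)$ is its inner normal fan (support $\mathrm{tail}(\Delta)^\vee$) and $\mathbb P(\Delta)$ the toric variety over $\mathbb C$ of this fan, with charts $U_\sigma=\mathrm{Spec}\,\mathbb C[\sigma^\vee\cap M]$. $\mathrm{Pol}^+(\Sigma)$ consists of the lattice polyhedra $\nabla$ with tail cone $|\Sigma|^\vee$ such that $v\mapsto\min\langle\nabla,v\rangle$ is linear on each cone of $\Sigma$ (also the empty set is included, but is not meant by "lattice polyhedra"). For such $\nabla$, $\mathcal O_X(\nabla)$ is the nef $T$-equivariant line bundle, a subsheaf of $j_*\mathcal O_T$ ($j:T\hookrightarrow X$), with $\Gamma(U_\sigma,\mathcal O_X(\nabla))=\bigoplus_{m\in(\nabla+\sigma^\vee)\cap M}\mathbb C\chi^m$; inclusions of polyhedra give inclusions of sheaves, and a matrix entry $\pm1$ means $\pm$ the inclusion. $\mathcal O_X(\Delta^+-\Delta^-):=\mathcal O_X(\Delta^+)\otimes\mathcal O_X(\Delta^-)^{-1}$. Cohomology and Ext groups of these equivariant sheaves are $M$-graded; subscript $0$ is the degree $0\in M$ part. $\widetilde H^0(Z,\mathbb C)$ is the space of locally constant functions $Z\to\mathbb C$ modulo constants; $[C_i]$ is the class of the indicator function of the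 component $C_i$. Identification $\mathrm{Ext}^1(\mathcal O_X(\Delta^-),\mathcal O_X(\Delta^+))_0=\widetilde H^0(\Delta^-\setminus\Delta^+,\mathbb C)$: put $\mathcal L=\mathcal O_X(\Delta^+-\Delta^-)$. (1) An extension is tensored with $\mathcal O_X(\Delta^-)^{-1}$ to give $0\to\mathcal L\to\mathcal E\to\mathcal O_X\to0$, and its class is the image of $1\in\Gamma(X,\mathcal O_X)$ under the connecting homomorphism to $H^1(X,\mathcal L)$. (2) $H^1(X,\mathcal L)$ is computed by Čech cohomology for the covering by $U_i=U_{\sigma_i}$, $\sigma_1,\dots,\sigma_k$ the maximal cones of $\Sigma$, with differential $(\delta s)_{ij}=s_j-s_i$. For $\tau\in\Sigma$ let $S(\tau)=\Delta^-\setminus(\Delta^++\tau^\vee)$; then $\mathcal L(U_\tau)_0=\mathbb C$ if $S(\tau)=\emptyset$ and $0$ otherwise, and each nonempty $S(\sigma_i)$ is connected. (3) The (known) isomorphism $\widetilde H^0(\Delta^-\setminus\Delta^+,\mathbb C)\to H^1(X,\mathcal L)_0$ (coming from the boundary map $H^0(\Delta^-\setminus\Delta^+)\to H^1(\Delta^-,\Delta^-\setminus\Delta^+)$) sends the class of a locally constant function $f$ to the class of the cocycle $(c_j-c_i)_{i<j}\in\prod_{i<j}\mathcal L(U_i\cap U_j)_0$, where $c_i$ is the value of $f$ on $S(\sigma_i)$ if $S(\sigma_i)\neq\emptyset$ and $c_i\in\mathbb C$ is arbitrary otherwise. *)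

theory Defs
  imports
    "HOL-Analysis.Analysis"
    "HOL-Library.Poly_Mapping"
    "HOL-Computational_Algebra.Polynomial_Factorial"
    "HOL-Algebra.Ideal"
begin

section \<open>Lattice, polyhedra and the normal fan\<close>

text \<open>
  The lattice \<open>M\<close> of rank \<open>CARD('n)\<close> is the type \<open>'n \<Rightarrow>\<^sub>0 int\<close>, and both \<open>M\<^sub>\<real>\<close> and \<open>N\<^sub>\<real>\<close> are
  \<open>real ^ 'n\<close>, paired by the inner product. The linear order on the index type \<open>'n\<close> serves only
  to obtain the library's \<open>idom\<close> instance for the Laurent polynomial ring \<open>\<complex>[M]\<close> below.
\<close>

type_synonym 'n real_space = "(real, 'n) vec"
type_synonym 'n lattice = "'n \<Rightarrow>\<^sub>0 int"

definition to_real_vec :: "'n::finite lattice \<Rightarrow> 'n real_space" where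
  "to_real_vec m = (\<chi> i. real_of_int (Poly_Mapping.lookup m i))"

definition lattice_polyhedron :: "'n::finite real_space set \<Rightarrow> bool" where
  "lattice_polyhedron P \<longleftrightarrow>
     polyhedron P \<and> (\<exists>v. v extreme_point_of P) \<and>
     (\<forall>v. v extreme_point_of P \<longrightarrow> v \<in> range to_real_vec)"

definition tail_cone :: "'n::finite real_space set \<Rightarrow> 'n real_space set" where
  "tail_cone P = {d. \<forall>x\<in>P. \<forall>t\<ge>0. x + t *\<^sub>R d \<in> P}"

definition dual_cone :: "'n::finite real_space set \<Rightarrow> 'n real_space set" where
  "dual_cone C = {x. \<forall>v\<in>C. 0 \<le> v \<bullet> x}"

definition normal_cone :: "'n::finite real_space set \<Rightarrow> 'n real_space set \<Rightarrow> 'n real_space set" where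
  "normal_cone P F = {v. \<forall>x\<in>F. \<forall>y\<in>P. v \<bullet> x \<le> v \<bullet> y}"

definition normal_fan :: "'n::finite real_space set \<Rightarrow> 'n real_space set set" where
  "normal_fan P = {normal_cone P F | F. F face_of P \<and> F \<noteq> {}}"

definition maximal_cones :: "'n::finite real_space set set \<Rightarrow> 'n real_space set set" where
  "maximal_cones \<Sigma> = {\<sigma> \<in> \<Sigma>. \<forall>\<tau>\<in>\<Sigma>. \<sigma> \<subseteq> \<tau> \<longrightarrow> \<tau> = \<sigma>}"

text \<open>
  On \<open>|\<Sigma>|\<close> the infimum below is a minimum, because the tail cone of \<open>P\<close> is dual to \<open>|\<Sigma>|\<close>.
\<close>

definition Pol_plus :: "'n::finite real_space set set \<Rightarrow> 'n real_space set set" where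
  "Pol_plus \<Sigma> = insert {} {P. lattice_polyhedron P \<and> tail_cone P = dual_cone (\<Union>\<Sigma>) \<and>
     (\<forall>\<tau>\<in>\<Sigma>. \<exists>m. \<forall>v\<in>\<tau>. (INF x\<in>P. v \<bullet> x) = v \<bullet> m)}"


section \<open>The toric variety of a fan\<close>

text \<open>
  The variety is integral and separated, so it is described (as a scheme in the sense of
  Chevalley) inside its function field \<open>K = Frac \<complex>[M]\<close>: a point is identified with its local
  ring, a subring of \<open>K\<close>. Thus \<open>Spec A\<close>, for a subring \<open>A\<close> of \<open>K\<close>, is the set of the
  localizations of \<open>A\<close> at its prime ideals, and gluing the charts is taking their union.
\<close>

type_synonym 'n laurent = "'n lattice \<Rightarrow>\<^sub>0 complex"
type_synonym 'n function_field = "'n laurent fract"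

text \<open>\<open>\<Oplus>\<^bsub>m \<in> S \<inter> M\<^esub> \<complex> \<chi>\<^sup>m\<close>\<close>

definition character_span ::
    "'n::{finite,linorder} real_space set \<Rightarrow> 'n function_field set" where
  "character_span S = to_fract ` {f :: 'n laurent. \<forall>m \<in> Poly_Mapping.keys f. to_real_vec m \<in> S}"

definition ring_on :: "'k::field set \<Rightarrow> 'k ring" where
  "ring_on A = \<lparr>carrier = A, mult = (*), one = 1, zero = 0, add = (+)\<rparr>"

definition localization :: "'k::field set \<Rightarrow> 'k set \<Rightarrow> 'k set" where
  "localization A \<pp> = {a / b | a b. a \<in> A \<and> b \<in> A - \<pp>}"

definition spec :: "'k::field set \<Rightarrow> 'k set set" where
  "spec A = {localization A \<pp> | \<pp>. primeideal \<pp> (ring_on A)}"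

definition basic_open :: "'k::field set \<Rightarrow> 'k \<Rightarrow> 'k set set" where
  "basic_open A f = {localization A \<pp> | \<pp>. primeideal \<pp> (ring_on A) \<and> f \<notin> \<pp>}"

definition chart_ring ::
    "'n::{finite,linorder} real_space set \<Rightarrow> 'n function_field set" where
  "chart_ring \<tau> = character_span (dual_cone \<tau>)"

definition chart ::
    "'n::{finite,linorder} real_space set \<Rightarrow> 'n function_field set set" where
  "chart \<tau> = spec (chart_ring \<tau>)"

definition toric_variety ::
    "'n::{finite,linorder} real_space set set \<Rightarrow> 'n function_field set topology" where
  "toric_variety \<Sigma> = topology_generated_by
     {basic_open (chart_ring \<tau>) f | \<tau> f. \<tau> \<in> \<Sigma> \<and> f \<in> chart_ring \<tau>}"


section \<open>Sheaves\<close>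

text \<open>
  All sheaves that occur are subsheaves of the constant sheaf \<open>K\<close> or \<open>K \<times> K\<close> on an irreducible
  space. They are given by their sections over the open sets; restriction to a nonempty open set
  is the inclusion, and the sections over the empty set are zero.

  As points are local rings, the regular functions on \<open>V\<close> are the elements of \<open>\<Inter>V\<close>.
\<close>

definition structure_sheaf :: "'k::field set set \<Rightarrow> 'k set" where
  "structure_sheaf V = (if V = {} then {0} else \<Inter>V)"

text \<open>
  The sheaf \<open>\<O>(P)\<close>: the subsheaf of \<open>K\<close> which on the chart of \<open>\<tau>\<close> is associated with the module
  \<open>\<Oplus>\<^bsub>m \<in> (P + \<tau>\<^sup>\<or>) \<inter> M\<^esub> \<complex> \<chi>\<^sup>m\<close>. Its stalk at a point \<open>x\<close> of this chart is the localization of the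
  module, whose elements are the products \<open>u * g\<close> with \<open>u \<in> x\<close> and \<open>g\<close> in the module. Since every
  \<open>g\<close> lies in \<open>\<complex>[M]\<close>, it is contained in the direct image of the structure sheaf of the torus.
\<close>

definition toric_sheaf ::
    "'n::{finite,linorder} real_space set set \<Rightarrow> 'n real_space set \<Rightarrow>
     'n function_field set set \<Rightarrow> 'n function_field set" where
  "toric_sheaf \<Sigma> P V = (if V = {} then {0} else
     {s. \<forall>x\<in>V. \<exists>\<tau>\<in>\<Sigma>. x \<in> chart \<tau> \<and>
        (\<exists>u\<in>x. \<exists>g\<in>character_span (P + dual_cone \<tau>). s = u * g)})"

definition direct_sum ::
    "('p set \<Rightarrow> 'v set) \<Rightarrow> ('p set \<Rightarrow> 'w set) \<Rightarrow> 'p set \<Rightarrow> ('v \<times> 'w) set" where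
  "direct_sum F G V = F V \<times> G V"

text \<open>
  Sheaf Hom into the structure sheaf: homomorphisms between nonzero subsheaves of \<open>K\<close> are
  multiplications by elements of \<open>K\<close>.
\<close>

definition inverse_sheaf ::
    "'k::field set topology \<Rightarrow> ('k set set \<Rightarrow> 'k set) \<Rightarrow> 'k set set \<Rightarrow> 'k set" where
  "inverse_sheaf X F V = (if V = {} then {0} else
     {t. \<forall>W. openin X W \<and> W \<subseteq> V \<longrightarrow> (\<forall>s\<in>F W. t * s \<in> structure_sheaf W)})"

text \<open>
  Tensor product \<open>F \<otimes> G\<close> of a subsheaf \<open>F\<close> of a \<open>K\<close>-vector space, with scalar multiplication
  \<open>sm\<close>, and an invertible subsheaf \<open>G\<close> of \<open>K\<close>. As \<open>G\<close> is flat, \<open>F \<otimes> G\<close> is the image under \<open>sm\<close>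
  in that vector space, i.e. the sheaf of the sections that locally are finite sums of products.
\<close>

definition tensor_sheaf ::
    "('k::field \<Rightarrow> 'v::ab_group_add \<Rightarrow> 'v) \<Rightarrow> 'k set topology \<Rightarrow>
     ('k set set \<Rightarrow> 'v set) \<Rightarrow> ('k set set \<Rightarrow> 'k set) \<Rightarrow> 'k set set \<Rightarrow> 'v set" where
  "tensor_sheaf sm X F G V = (if V = {} then {0} else
     {s. \<forall>x\<in>V. \<exists>W. openin X W \<and> x \<in> W \<and> W \<subseteq> V \<and>
        (\<exists>(r::nat) a b. (\<forall>i<r. a i \<in> F W \<and> b i \<in> G W) \<and> s = (\<Sum>i<r. sm (b i) (a i)))})"

definition scale_pair :: "'k::field \<Rightarrow> 'k \<times> 'k \<Rightarrow> 'k \<times> 'k" where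
  "scale_pair c p = (c * fst p, c * snd p)"

definition toric_sheaf_diff ::
    "'n::{finite,linorder} real_space set set \<Rightarrow> 'n real_space set \<Rightarrow> 'n real_space set \<Rightarrow>
     'n function_field set set \<Rightarrow> 'n function_field set" where
  "toric_sheaf_diff \<Sigma> P Q = tensor_sheaf (*) (toric_variety \<Sigma>)
     (toric_sheaf \<Sigma> P) (inverse_sheaf (toric_variety \<Sigma>) (toric_sheaf \<Sigma> Q))"

text \<open>
  Exactness of \<open>0 \<rightarrow> A \<rightarrow> B \<rightarrow> C \<rightarrow> 0\<close> for morphisms induced by \<open>K\<close>-linear maps \<open>f\<close> and \<open>g\<close> of the
  ambient vector spaces. Surjectivity is required only locally.
\<close>

definition short_exact_sheaves ::
    "'p topology \<Rightarrow> ('u \<Rightarrow> 'v) \<Rightarrow> ('v \<Rightarrow> 'w::zero) \<Rightarrow>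
     ('p set \<Rightarrow> 'u set) \<Rightarrow> ('p set \<Rightarrow> 'v set) \<Rightarrow> ('p set \<Rightarrow> 'w set) \<Rightarrow> bool" where
  "short_exact_sheaves X f g A B C \<longleftrightarrow>
     (\<forall>V. openin X V \<longrightarrow>
        f ` A V \<subseteq> B V \<and> g ` B V \<subseteq> C V \<and>
        inj_on f (A V) \<and> f ` A V = {b \<in> B V. g b = 0} \<and>
        (\<forall>c\<in>C V. \<forall>x\<in>V. \<exists>W. openin X W \<and> x \<in> W \<and> W \<subseteq> V \<and> c \<in> g ` B W))"


text \<open>
  Complex points of the torus are the homomorphisms from \<open>M\<close> to the nonzero complex numbers (by the
  two conditions below, the value 0 is not taken). They act on \<open>\<complex>[M]\<close> by \<open>\<chi>\<^sup>m \<mapsto> t(m) \<chi>\<^sup>m\<close>, hence on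
  \<open>K\<close>, and on the points of the variety by taking images of local rings. Subsheaves of
  \<open>K\<close> inherit their equivariant structure from this action.
\<close>

definition torus :: "('n lattice \<Rightarrow> complex) set" where
  "torus = {t. t 0 = 1 \<and> (\<forall>m m'. t (m + m') = t m * t m')}"

definition torus_act_laurent :: "('n lattice \<Rightarrow> complex) \<Rightarrow> 'n laurent \<Rightarrow> 'n laurent" where
  "torus_act_laurent t = Poly_Mapping.mapp (\<lambda>m c. t m * c)"

definition torus_act ::
    "('n::{finite,linorder} lattice \<Rightarrow> complex) \<Rightarrow> 'n function_field \<Rightarrow> 'n function_field" where
  "torus_act t q = (THE r. \<exists>a b. b \<noteq> 0 \<and> q = Fract a b \<and>
     r = Fract (torus_act_laurent t a) (torus_act_laurent t b))"

definition torus_act_pair ::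
    "('n::{finite,linorder} lattice \<Rightarrow> complex) \<Rightarrow>
     'n function_field \<times> 'n function_field \<Rightarrow> 'n function_field \<times> 'n function_field" where
  "torus_act_pair t = map_prod (torus_act t) (torus_act t)"

definition equivariant_sheaf ::
    "'n::{finite,linorder} function_field set topology \<Rightarrow>
     (('n lattice \<Rightarrow> complex) \<Rightarrow> 'v \<Rightarrow> 'v) \<Rightarrow> ('n function_field set set \<Rightarrow> 'v set) \<Rightarrow> bool" where
  "equivariant_sheaf X act F \<longleftrightarrow>
     (\<forall>t\<in>torus. \<forall>V. openin X V \<longrightarrow> F ((\<lambda>x. torus_act t ` x) ` V) = act t ` F V)"

definition equivariant_map ::
    "(('n lattice \<Rightarrow> complex) \<Rightarrow> 'v \<Rightarrow> 'v) \<Rightarrow> (('n lattice \<Rightarrow> complex) \<Rightarrow> 'w \<Rightarrow> 'w) \<Rightarrow>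
     ('v \<Rightarrow> 'w) \<Rightarrow> bool" where
  "equivariant_map act act' f \<longleftrightarrow> (\<forall>t\<in>torus. \<forall>s. f (act t s) = act' t (f s))"


section \<open>Cech cohomology and the class of an extension\<close>

definition function_group ::
    "('i \<Rightarrow> 'v::ab_group_add) set \<Rightarrow> 'i set \<Rightarrow> ('i \<Rightarrow> 'v) monoid" where
  "function_group S I =
     \<lparr>carrier = S, mult = (\<lambda>s t. \<lambda>i\<in>I. s i + t i), one = (\<lambda>i\<in>I. 0)\<rparr>"

definition pairs :: "nat \<Rightarrow> (nat \<times> nat) set" where
  "pairs k = {(i, j). 1 \<le> i \<and> i < j \<and> j \<le> k}"

definition cech_Z1 ::
    "nat \<Rightarrow> (nat \<Rightarrow> 'p set) \<Rightarrow> ('p set \<Rightarrow> 'v::ab_group_add set) \<Rightarrow> (nat \<times> nat \<Rightarrow> 'v) set" where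
  "cech_Z1 k U F = {s \<in> (\<Pi>\<^sub>E (i, j) \<in> pairs k. F (U i \<inter> U j)).
     \<forall>i j l. 1 \<le> i \<and> i < j \<and> j < l \<and> l \<le> k \<longrightarrow> s (j, l) - s (i, l) + s (i, j) = 0}"

definition cech_B1 ::
    "nat \<Rightarrow> (nat \<Rightarrow> 'p set) \<Rightarrow> ('p set \<Rightarrow> 'v::ab_group_add set) \<Rightarrow> (nat \<times> nat \<Rightarrow> 'v) set" where
  "cech_B1 k U F = {(\<lambda>(i, j) \<in> pairs k. b j - b i) | b. \<forall>i\<in>{1..k}. b i \<in> F (U i)}"

text \<open>
  Elements of \<open>H\<^sup>1 = Z\<^sup>1 / B\<^sup>1\<close> are cosets of \<open>B\<^sup>1\<close>; \<open>cech_H1_degree_zero\<close> consists of those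
  represented by cocycles of degree \<open>0 \<in> M\<close>, i.e. with values in \<open>\<complex> \<chi>\<^sup>0\<close>.
\<close>

definition cech_class ::
    "nat \<Rightarrow> (nat \<Rightarrow> 'p set) \<Rightarrow> ('p set \<Rightarrow> 'v::ab_group_add set) \<Rightarrow>
     (nat \<times> nat \<Rightarrow> 'v) \<Rightarrow> (nat \<times> nat \<Rightarrow> 'v) set" where
  "cech_class k U F s = cech_B1 k U F #>\<^bsub>function_group (cech_Z1 k U F) (pairs k)\<^esub> s"

definition const_section :: "complex \<Rightarrow> 'n::{finite,linorder} function_field" where
  "const_section c = to_fract (Poly_Mapping.single 0 c)"

definition degree_zero ::
    "('p set \<Rightarrow> 'n::{finite,linorder} function_field set) \<Rightarrow> 'p set \<Rightarrow> 'n function_field set" where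
  "degree_zero F V = F V \<inter> range const_section"

definition cech_H1_degree_zero ::
    "nat \<Rightarrow> (nat \<Rightarrow> 'p set) \<Rightarrow> ('p set \<Rightarrow> 'n::{finite,linorder} function_field set) \<Rightarrow>
     (nat \<times> nat \<Rightarrow> 'n function_field) set set" where
  "cech_H1_degree_zero k U F = cech_class k U F ` cech_Z1 k U (degree_zero F)"

text \<open>Image of a global section \<open>t\<close> of \<open>C\<close> for an exact sequence \<open>0 \<rightarrow> A \<rightarrow> B \<rightarrow> C \<rightarrow> 0\<close>.\<close>

definition connecting_hom ::
    "nat \<Rightarrow> (nat \<Rightarrow> 'p set) \<Rightarrow> ('u::ab_group_add \<Rightarrow> 'v::ab_group_add) \<Rightarrow> ('v \<Rightarrow> 'w) \<Rightarrow>
     ('p set \<Rightarrow> 'u set) \<Rightarrow> ('p set \<Rightarrow> 'v set) \<Rightarrow> 'w \<Rightarrow> (nat \<times> nat \<Rightarrow> 'u) set" where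
  "connecting_hom k U f g A B t = (THE h. \<exists>e s.
     (\<forall>i\<in>{1..k}. e i \<in> B (U i) \<and> g (e i) = t) \<and>
     s \<in> cech_Z1 k U A \<and>
     (\<forall>(i, j) \<in> pairs k. f (s (i, j)) = e j - e i) \<and>
     h = cech_class k U A s)"

text \<open>
  The class in \<open>H\<^sup>1(X, \<O>(P) \<otimes> \<O>(Q)\<^sup>-\<^sup>1)\<close> of an extension \<open>0 \<rightarrow> \<O>(P) \<rightarrow> B \<rightarrow> \<O>(Q) \<rightarrow> 0\<close> with
  \<open>B \<subseteq> K \<times> K\<close>. The \<open>K\<close>-linear maps \<open>f\<close> and \<open>g\<close> also induce the tensored sequence.
\<close>

definition extension_class ::
    "'n::{finite,linorder} real_space set set \<Rightarrow> nat \<Rightarrow> (nat \<Rightarrow> 'n real_space set) \<Rightarrow>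
     ('n function_field \<Rightarrow> 'n function_field \<times> 'n function_field) \<Rightarrow>
     ('n function_field \<times> 'n function_field \<Rightarrow> 'n function_field) \<Rightarrow>
     'n real_space set \<Rightarrow>
     ('n function_field set set \<Rightarrow> ('n function_field \<times> 'n function_field) set) \<Rightarrow>
     'n real_space set \<Rightarrow> (nat \<times> nat \<Rightarrow> 'n function_field) set" where
  "extension_class \<Sigma> k \<sigma> f g P B Q = connecting_hom k (\<lambda>i. chart (\<sigma> i)) f g
     (toric_sheaf_diff \<Sigma> P Q)
     (tensor_sheaf scale_pair (toric_variety \<Sigma>) B
        (inverse_sheaf (toric_variety \<Sigma>) (toric_sheaf \<Sigma> Q)))
     1"


section \<open>Reduced cohomology and its comparison with Cech cohomology\<close>

definition locally_constant_functions ::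
    "'a::topological_space set \<Rightarrow> ('a \<Rightarrow> complex) set" where
  "locally_constant_functions Z = {f \<in> extensional Z.
     \<forall>z\<in>Z. \<exists>W. openin (top_of_set Z) W \<and> z \<in> W \<and> f constant_on W}"

definition constant_functions :: "'a set \<Rightarrow> ('a \<Rightarrow> complex) set" where
  "constant_functions Z = range (\<lambda>c. \<lambda>z\<in>Z. c)"

definition reduced_H0 :: "'a::topological_space set \<Rightarrow> ('a \<Rightarrow> complex) set monoid" where
  "reduced_H0 Z = function_group (locally_constant_functions Z) Z Mod constant_functions Z"

definition component_class ::
    "'a::topological_space set \<Rightarrow> 'a set \<Rightarrow> ('a \<Rightarrow> complex) set" where
  "component_class Z C =
     constant_functions Z #>\<^bsub>function_group (locally_constant_functions Z) Z\<^esub>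
       (\<lambda>z\<in>Z. indicator C z)"

text \<open>
  The isomorphism from the reduced \<open>H\<^sup>0\<close> of \<open>Q - P\<close> to the degree zero part of
  \<open>H\<^sup>1(X, \<O>(P) \<otimes> \<O>(Q)\<^sup>-\<^sup>1)\<close>, evaluated at a class \<open>\<alpha>\<close> of locally constant functions. The number
  \<open>c i\<close> is unconstrained when \<open>Q - (P + dual_cone (\<sigma> i))\<close> is empty.
\<close>

definition reduced_H0_to_cech_H1 ::
    "'n::{finite,linorder} real_space set set \<Rightarrow> nat \<Rightarrow> (nat \<Rightarrow> 'n real_space set) \<Rightarrow>
     'n real_space set \<Rightarrow> 'n real_space set \<Rightarrow> ('n real_space \<Rightarrow> complex) set \<Rightarrow>
     (nat \<times> nat \<Rightarrow> 'n function_field) set" where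
  "reduced_H0_to_cech_H1 \<Sigma> k \<sigma> P Q \<alpha> =
     (let L = toric_sheaf_diff \<Sigma> P Q; U = (\<lambda>i. chart (\<sigma> i)) in
      THE h. \<exists>f\<in>\<alpha>. \<exists>c s.
        (\<forall>i\<in>{1..k}. \<forall>z \<in> Q - (P + dual_cone (\<sigma> i)). f z = c i) \<and>
        s = (\<lambda>(i, j) \<in> pairs k. const_section (c j - c i)) \<and>
        s \<in> cech_Z1 k U (degree_zero L) \<and>
        h = cech_class k U L s)"

end

theory Submission
  imports Defs
begin

text \<open>
  On the chart of \<open>\<tau>\<close> the sheaf \<open>\<O>(P)\<close> is generated by \<open>\<chi>\<^sup>m\<close>, for a lattice point \<open>m\<close> of \<open>P\<close> at
  which all functionals in \<open>\<tau>\<close> are minimal on \<open>P\<close>. Such an \<open>m\<close> for \<open>\<Delta>\<^sup>-\<close> lies in \<open>\<nabla>\<^sub>0\<close> or in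
  \<open>\<nabla>\<^sub>1\<close>. Say it is in \<open>\<nabla>\<^sub>0\<close>: then \<open>\<O>(\<nabla>\<^sub>0) = \<O>(\<Delta>\<^sup>-)\<close> on the chart, and \<open>\<O>(\<nabla>\<^sub>1) = \<O>(\<Delta>\<^sup>+)\<close>, because
  a segment from \<open>C\<^sub>0\<close> to \<open>C\<^sub>1\<close> inside \<open>\<Delta>\<^sup>-\<close> meets \<open>\<Delta>\<^sup>+\<close>. This gives exactness, and \<open>(1, 0)\<close> is a
  lift of 1 on the chart; on the other charts \<open>(0, 1)\<close> is one. The differences of these lifts form
  the cocycle of the function that is 0 on \<open>C\<^sub>0\<close> and 1 on \<open>C\<^sub>1\<close>.
\<close>

text \<open>All sheaves are families of subsets of one field or of its square. A stalk of O(P) is a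
  monomial times a local ring, so membership in a sheaf turns into the question whether some field
  element lies in that local ring. The topology of the difference enters the sheaf computations only
  through the crossing segment. Both classes to be compared are definite descriptions. Exhibiting
  lifts or a representative function is therefore not enough: every admissible choice has to give
  the same class. Each side is compared with one explicit cocycle of constants. The sign comes from
  f(s) = (-s, s): the cocycle is read off the second components of the lifts, which are 0 on the
  \<open>C0\<close> side and 1 on the \<open>C1\<close> side. This selects the class of
  \<open>C1\<close>. If a minimal point of the larger polyhedron lies in the smaller one, both sides
  are eligible on that chart. The constants are then sections of L there, so the choice does not
  change the class. Sections over the empty set are zero by convention, so intersections of charts
  must be known to be nonempty; the generic point provides this.\<close>

section \<open>Minimal vertices of polyhedra\<close>

text \<open>
  Among the points of \<open>P\<close> at which \<open>v\<close> is at most \<open>v \<bullet> x\<close>, one with the most active constraints is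
  extreme: otherwise one could move along a line that keeps the active constraints, in a direction
  that does not increase \<open>v\<close>, until another constraint becomes active.
\<close>

lemma polyhedron_below_extreme_point:
  fixes P :: "'a::euclidean_space set"
  assumes P: "polyhedron P" and e: "e extreme_point_of P" and x: "x \<in> P"
    and v: "\<And>d. (\<forall>y\<in>P. \<forall>t\<ge>0. y + t *\<^sub>R d \<in> P) \<Longrightarrow> 0 \<le> v \<bullet> d"
  obtains y where "y extreme_point_of P" "v \<bullet> y \<le> v \<bullet> x"
proof -
  obtain F where F: "finite F" "P = \<Inter>F" and "\<forall>h\<in>F. \<exists>a b. a \<noteq> 0 \<and> h = {x. a \<bullet> x \<le> b}"
    using P unfolding polyhedron_def by blast
  then obtain a b where h: "\<And>h. h \<in> F \<Longrightarrow> h = {x. a h \<bullet> x \<le> b h}"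
    by metis
  have inP: "z \<in> P \<longleftrightarrow> (\<forall>h\<in>F. a h \<bullet> z \<le> b h)" for z
    using F(2) h by blast
  define act where "act z = {h\<in>F. a h \<bullet> z = b h}" for z
  define Q where "Q = {z \<in> P. v \<bullet> z \<le> v \<bullet> x}"
  have "card (act z) < Suc (card F)" for z
    unfolding act_def using F(1) by (simp add: card_mono less_Suc_eq_le)
  then obtain y where y: "y \<in> Q" and ymax: "\<And>z. z \<in> Q \<Longrightarrow> card (act z) \<le> card (act y)"
    using ex_has_greatest_nat[of "\<lambda>z. z \<in> Q" x "\<lambda>z. card (act z)" "Suc (card F)"] x
    by (auto simp: Q_def)
  have yP: "y \<in> P" and yx: "v \<bullet> y \<le> v \<bullet> x" using y by (auto simp: Q_def)
  have step: False if d: "\<And>h. h \<in> act y \<Longrightarrow> a h \<bullet> d = 0" and vd: "v \<bullet> d \<le> 0"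
    and h0: "h0 \<in> F" "a h0 \<bullet> d > 0" for d h0
  proof -
    \<comment> \<open>As in the ratio test of the simplex method, \<open>G\<close> collects the
      constraints that tighten along \<open>d\<close>, and the least ratio \<open>t\<close> is the
      longest step that violates none of them.\<close>
    define G where "G = {h\<in>F. a h \<bullet> d > 0}"
    define q where "q h = (b h - a h \<bullet> y) / (a h \<bullet> d)" for h
    have G: "finite G" "G \<noteq> {}" using F h0 by (auto simp: G_def)
    define t where "t = Min (q ` G)"
    have "t \<in> q ` G" unfolding t_def using G by (intro Min_in) auto
    then obtain h1 where h1: "h1 \<in> G" "t = q h1" by blast
    have tle: "t \<le> q h" if "h \<in> G" for h using that G by (auto simp: t_def)
    have t0: "0 \<le> t" using h1 yP inP by (auto simp: q_def G_def)
    define z where "z = y + t *\<^sub>R d"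
    have zh: "a h \<bullet> z = a h \<bullet> y + t * (a h \<bullet> d)" for h
      by (simp add: z_def inner_simps)
    have "a h \<bullet> z \<le> b h" if "h \<in> F" for h
    proof (cases "a h \<bullet> d > 0")
      case True
      then have "t \<le> q h" using tle that by (auto simp: G_def)
      then show ?thesis using True unfolding zh q_def by (simp add: field_simps)
    next
      case False
      then have "t * (a h \<bullet> d) \<le> 0" using t0 by (simp add: mult_nonneg_nonpos)
      then show ?thesis using yP inP that unfolding zh by fastforce
    qed
    then have "z \<in> P" using inP by blast
    moreover have "v \<bullet> z \<le> v \<bullet> y"
      using vd t0 by (simp add: z_def inner_simps mult_nonneg_nonpos)
    ultimately have "z \<in> Q" using yx by (simp add: Q_def)
    moreover have "insert h1 (act y) \<subseteq> act z"
      using h1 d by (auto simp: act_def zh q_def G_def)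
    moreover have "h1 \<notin> act y" using h1 d by (auto simp: G_def)
    moreover have "finite (act z)" using F by (simp add: act_def)
    ultimately have "card (act y) < card (act z)"
      by (metis card_insert_disjoint card_mono finite_insert finite_subset Suc_le_eq)
    then show False using ymax[OF \<open>z \<in> Q\<close>] by simp
  qed
  have ray: "\<forall>z\<in>P. \<forall>t\<ge>0. z + t *\<^sub>R d \<in> P" if "\<And>h. h \<in> F \<Longrightarrow> a h \<bullet> d \<le> 0" for d
  proof (intro ballI allI impI)
    fix z and t :: real assume z: "z \<in> P" and t: "0 \<le> t"
    show "z + t *\<^sub>R d \<in> P"
      unfolding inP
    proof
      fix h assume "h \<in> F"
      moreover from this have "t * (a h \<bullet> d) \<le> 0"
        using t that by (simp add: mult_nonneg_nonpos)
      ultimately show "a h \<bullet> (z + t *\<^sub>R d) \<le> b h"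
        using z unfolding inP by (fastforce simp: inner_simps)
    qed
  qed
  have "y extreme_point_of P"
  proof (rule ccontr)
    assume "\<not> ?thesis"
    then obtain p q where pq: "p \<in> P" "q \<in> P" "y \<in> open_segment p q"
      using yP by (auto simp: extreme_point_of_def)
    then obtain u where u: "0 < u" "u < 1" "y = (1 - u) *\<^sub>R p + u *\<^sub>R q" and ne: "p \<noteq> q"
      by (auto simp: in_segment)
    define d where "d = q - p"
    have d0: "a h \<bullet> d = 0" if "h \<in> act y" for h
    proof -
      have le: "a h \<bullet> p \<le> b h" "a h \<bullet> q \<le> b h"
        using that pq inP by (auto simp: act_def)
      have eq: "(1 - u) * (a h \<bullet> p) + u * (a h \<bullet> q) = b h"
        using that u by (simp add: act_def inner_simps)
      have "(1 - u) * (b h - a h \<bullet> p) + u * (b h - a h \<bullet> q) = 0"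
        using eq by (simp add: algebra_simps)
      moreover have "(1 - u) * (b h - a h \<bullet> p) \<ge> 0" "u * (b h - a h \<bullet> q) \<ge> 0"
        using u le by simp_all
      ultimately have "(1 - u) * (b h - a h \<bullet> p) = 0" "u * (b h - a h \<bullet> q) = 0" by linarith+
      then show ?thesis using u by (simp add: d_def inner_simps)
    qed
    \<comment> \<open>If all constraints were constant along \<open>c\<close>, then \<open>P\<close>
      would contain a line through \<open>e\<close> in this direction, and \<open>e\<close> would be
      the midpoint of a segment in \<open>P\<close>.\<close>
    have noline: "\<exists>h\<in>F. a h \<bullet> c \<noteq> 0" if "c \<noteq> 0" for c
    proof (rule ccontr)
      assume "\<not> ?thesis"
      then have "\<And>h. h \<in> F \<Longrightarrow> a h \<bullet> c = 0" by blast
      then have "\<forall>z\<in>P. \<forall>t\<ge>0. z + t *\<^sub>R c \<in> P" "\<forall>z\<in>P. \<forall>t\<ge>0. z + t *\<^sub>R (- c) \<in> P"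
        by (intro ray; simp)+
      moreover have "e \<in> P" using e by (simp add: extreme_point_of_def)
      ultimately have "e + 1 *\<^sub>R c \<in> P" "e + 1 *\<^sub>R (- c) \<in> P"
        using zero_le_one by blast+
      moreover have "e \<in> open_segment (e + 1 *\<^sub>R c) (e + 1 *\<^sub>R (- c))"
      proof -
        have "2 *\<^sub>R c \<noteq> 0" using that by simp
        then have "e + 1 *\<^sub>R c \<noteq> e + 1 *\<^sub>R (- c)" by (simp add: scaleR_2 eq_neg_iff_add_eq_0)
        moreover have "midpoint (e + 1 *\<^sub>R c) (e + 1 *\<^sub>R (- c)) = e"
          by (simp add: midpoint_def flip: scaleR_2)
        ultimately show ?thesis using midpoint_in_open_segment by metis
      qed
      ultimately show False using e by (auto simp: extreme_point_of_def)
    qed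
    \<comment> \<open>If no constraint tightens along \<open>c\<close>, then \<open>c\<close> is a
      recession direction, so \<open>v \<bullet> c = 0\<close> and \<open>- c\<close> is just as
      good; \<open>noline\<close> supplies a constraint that tightens along it.\<close>
    have main: False if c: "\<And>h. h \<in> act y \<Longrightarrow> a h \<bullet> c = 0" "v \<bullet> c \<le> 0" "c \<noteq> 0" for c
    proof (cases "\<exists>h\<in>F. a h \<bullet> c > 0")
      case True then show False using step c by blast
    next
      case False
      then have "0 \<le> v \<bullet> c" using ray v by force
      moreover obtain h where "h \<in> F" "a h \<bullet> (- c) > 0"
        using noline[OF c(3)] False by force
      moreover have "a h \<bullet> (- c) = 0" if "h \<in> act y" for h using c that by simp
      ultimately show False using step[of "- c" h] c by simp
    qed
    have d: "d \<noteq> 0" using ne by (simp add: d_def)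
    show False
    proof (cases "v \<bullet> d \<le> 0")
      case True
      then show False using main[of d] d0 d by simp
    next
      case False
      then show False using main[of "- d"] d0 d by simp
    qed
  qed
  with yx that show thesis by blast
qed

text \<open>Every point of \<open>P\<close> has a vertex that is at least as low, and there are only
  finitely many vertices; the lowest one is a global minimum.\<close>

lemma polyhedron_minimal_extreme_point:
  fixes v :: "'a::euclidean_space"
  assumes P: "polyhedron P" and e: "\<exists>e. e extreme_point_of P"
    and v: "\<And>d. (\<forall>y\<in>P. \<forall>t\<ge>0. y + t *\<^sub>R d \<in> P) \<Longrightarrow> 0 \<le> v \<bullet> d"
  obtains m where "m extreme_point_of P" "\<And>x. x \<in> P \<Longrightarrow> v \<bullet> m \<le> v \<bullet> x"
proof -
  define E where "E = {m. m extreme_point_of P}"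
  have E: "finite E" "E \<noteq> {}" using finite_polyhedron_extreme_points[OF P] e by (auto simp: E_def)
  obtain m where m: "m \<in> E" "\<And>y. y \<in> E \<Longrightarrow> v \<bullet> m \<le> v \<bullet> y"
    using arg_min_if_finite[OF E, of "\<lambda>y. v \<bullet> y"] by (metis not_le)
  show thesis
  proof
    show "m extreme_point_of P" using m by (simp add: E_def)
    fix x assume "x \<in> P"
    then obtain y where "y extreme_point_of P" "v \<bullet> y \<le> v \<bullet> x"
      using polyhedron_below_extreme_point[OF P _ _ v] e by metis
    then show "v \<bullet> m \<le> v \<bullet> x" using m(2)[of y] by (simp add: E_def)
  qed
qed

lemma convex_normal_cone: "convex (normal_cone P F)"
  unfolding normal_cone_def convex_alt
proof (clarsimp simp: inner_simps)
  fix x y u xa ya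
  assume *: "\<forall>xa\<in>F. \<forall>y\<in>P. x \<bullet> xa \<le> x \<bullet> y" "\<forall>x\<in>F. \<forall>ya\<in>P. y \<bullet> x \<le> y \<bullet> ya"
    "0 \<le> u" "u \<le> (1::real)" "xa \<in> F" "ya \<in> P"
  then show "(1 - u) * (x \<bullet> xa) + u * (y \<bullet> xa) \<le> (1 - u) * (x \<bullet> ya) + u * (y \<bullet> ya)"
    by (intro add_mono mult_left_mono) auto
qed

lemma zero_in_normal_cone: "0 \<in> normal_cone P F"
  by (simp add: normal_cone_def)

text \<open>
  A vertex minimising one relatively interior functional of \<open>\<tau>\<close> minimises every functional in \<open>\<tau>\<close>,
  because the support function of \<open>P\<close> is linear on \<open>\<tau>\<close>.
\<close>

lemma Pol_plus_vertex:
  fixes P :: "'n::finite real_space set"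
  assumes P: "P \<in> Pol_plus \<Sigma>" "P \<noteq> {}" and \<tau>: "\<tau> \<in> \<Sigma>" "convex \<tau>" "\<tau> \<noteq> {}"
  obtains m where "to_real_vec m \<in> P"
    "\<And>v y. \<lbrakk>v \<in> \<tau>; y \<in> P\<rbrakk> \<Longrightarrow> v \<bullet> to_real_vec m \<le> v \<bullet> y"
proof -
  have lp: "polyhedron P" "\<exists>v. v extreme_point_of P"
    "\<And>v. v extreme_point_of P \<Longrightarrow> v \<in> range to_real_vec"
    and tail: "tail_cone P = dual_cone (\<Union>\<Sigma>)"
    and lin: "\<exists>m. \<forall>v\<in>\<tau>. (INF x\<in>P. v \<bullet> x) = v \<bullet> m"
    using P \<tau> by (auto simp: Pol_plus_def lattice_polyhedron_def)
  have vmin: "\<exists>m. m extreme_point_of P \<and> (\<forall>x\<in>P. v \<bullet> m \<le> v \<bullet> x)" if "v \<in> \<tau>" for v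
  proof -
    have "0 \<le> v \<bullet> d" if "\<forall>y\<in>P. \<forall>t\<ge>0. y + t *\<^sub>R d \<in> P" for d
    proof -
      have "d \<in> dual_cone (\<Union>\<Sigma>)" using that tail[symmetric] by (simp add: tail_cone_def)
      then show ?thesis using \<open>v \<in> \<tau>\<close> \<tau> by (auto simp: dual_cone_def)
    qed
    then show ?thesis using polyhedron_minimal_extreme_point[OF lp(1,2)] by metis
  qed
  obtain v0 where v0: "v0 \<in> rel_interior \<tau>"
    using \<tau> rel_interior_eq_empty by blast
  then have v0\<tau>: "v0 \<in> \<tau>" using rel_interior_subset by blast
  obtain w where w: "\<And>v. v \<in> \<tau> \<Longrightarrow> (INF x\<in>P. v \<bullet> x) = v \<bullet> w" using lin by blast
  obtain m0 where m0: "m0 extreme_point_of P" "\<forall>x\<in>P. v0 \<bullet> m0 \<le> v0 \<bullet> x" using vmin[OF v0\<tau>] by blast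
  have m0P: "m0 \<in> P" using m0 by (simp add: extreme_point_of_def)
  have wle: "v \<bullet> w \<le> v \<bullet> y" if v: "v \<in> \<tau>" and y: "y \<in> P" for v y
  proof -
    obtain m where "\<forall>x\<in>P. v \<bullet> m \<le> v \<bullet> x" using vmin[OF v] by blast
    then have "bdd_below ((\<lambda>x. v \<bullet> x) ` P)" by (auto intro!: bdd_belowI2)
    then show ?thesis using cINF_lower[of "\<lambda>x. v \<bullet> x" P y] w v y by simp
  qed
  have "v0 \<bullet> m0 \<le> (INF x\<in>P. v0 \<bullet> x)" using m0 P by (intro cINF_greatest) auto
  then have eq0: "v0 \<bullet> m0 = v0 \<bullet> w" using wle[OF v0\<tau> m0P] w[OF v0\<tau>] by simp
  have "v \<bullet> m0 \<le> v \<bullet> y" if v: "v \<in> \<tau>" and y: "y \<in> P" for v y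
  proof -
    \<comment> \<open>As \<open>v0\<close> is relatively interior, the segment from \<open>v\<close>
      can be prolonged beyond \<open>v0\<close>. At its far end \<open>w\<close> bounds
      \<open>m0\<close> from below and at \<open>v0\<close> they agree, so at \<open>v\<close>, on
      the opposite side, the inequality is reversed.\<close>
    obtain s where s: "s > 1" "(1 - s) *\<^sub>R v + s *\<^sub>R v0 \<in> \<tau>"
      using convex_rel_interior_iff[of \<tau> v0] v0 \<tau> v by blast
    from wle[OF s(2) m0P] eq0 have "(s - 1) * (v \<bullet> m0) \<le> (s - 1) * (v \<bullet> w)"
      by (simp add: inner_simps algebra_simps)
    with s have "v \<bullet> m0 \<le> v \<bullet> w" by simp
    with wle[OF v y] show ?thesis by simp
  qed
  moreover obtain m where "m0 = to_real_vec m" using lp(3)[OF m0(1)] by blast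
  ultimately show thesis using that m0P by metis
qed

section \<open>Characters, charts and the generic point\<close>

lemma to_real_vec_add: "to_real_vec (m + m') = to_real_vec m + to_real_vec m'"
  by (simp add: to_real_vec_def vec_eq_iff lookup_add)

lemma to_real_vec_uminus: "to_real_vec (- m) = - to_real_vec m"
  by (simp add: to_real_vec_def vec_eq_iff)

lemma to_real_vec_diff: "to_real_vec (m - m') = to_real_vec m - to_real_vec m'"
  by (simp add: to_real_vec_def vec_eq_iff lookup_minus)

lemma to_real_vec_zero: "to_real_vec 0 = 0"
  by (simp add: to_real_vec_def vec_eq_iff)

definition monomial :: "'n::{finite,linorder} lattice \<Rightarrow> 'n function_field" where
  "monomial m = to_fract (Poly_Mapping.single m 1)"

lemma monomial_zero [simp]: "monomial 0 = 1"
  by (simp add: monomial_def)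

lemma monomial_add: "monomial (m + m') = monomial m * monomial m'"
  by (simp add: monomial_def mult_single flip: to_fract_mult)

lemma monomial_mult_uminus [simp]: "monomial m * monomial (- m) = 1" "monomial (- m) * monomial m = 1"
  by (simp_all flip: monomial_add)

lemma const_section_diff: "const_section (a - b) = const_section a - const_section b"
  by (simp add: const_section_def single_diff)

lemma const_section_zero [simp]: "const_section 0 = 0"
  by (simp add: const_section_def)

lemma const_section_one [simp]: "const_section 1 = 1"
  by (simp add: const_section_def)

lemma character_span_add:
  "\<lbrakk>f \<in> character_span S; g \<in> character_span S\<rbrakk> \<Longrightarrow> f + g \<in> character_span S"
  unfolding character_span_def using keys_add by (fastforce simp flip: to_fract_add)

lemma character_span_uminus: "f \<in> character_span S \<Longrightarrow> - f \<in> character_span S"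
  unfolding character_span_def
  by (auto simp: in_keys_iff simp flip: to_fract_uminus intro!: imageI)

lemma character_span_zero: "0 \<in> character_span S"
  unfolding character_span_def by (force intro: image_eqI[of _ _ 0])

lemma character_span_mult:
  assumes "f \<in> character_span S" "g \<in> character_span T"
    "\<And>x y. \<lbrakk>x \<in> S; y \<in> T\<rbrakk> \<Longrightarrow> x + y \<in> R"
  shows "f * g \<in> character_span R"
proof -
  obtain p q where "f = to_fract p" "\<forall>m \<in> Poly_Mapping.keys p. to_real_vec m \<in> S"
    and "g = to_fract q" "\<forall>m \<in> Poly_Mapping.keys q. to_real_vec m \<in> T"
    using assms unfolding character_span_def by blast
  moreover from this have "\<forall>m \<in> Poly_Mapping.keys (p * q). to_real_vec m \<in> R"
    using keys_mult[of p q] assms(3) by (fastforce simp: to_real_vec_add)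
  ultimately show ?thesis
    unfolding character_span_def by (simp flip: to_fract_mult)
qed

lemma monomial_in_character_span: "to_real_vec m \<in> S \<Longrightarrow> monomial m \<in> character_span S"
  unfolding character_span_def monomial_def by auto

lemma const_in_character_span: "0 \<in> S \<Longrightarrow> const_section c \<in> character_span S"
  unfolding character_span_def const_section_def by (auto simp: to_real_vec_zero)

lemma dual_cone_add: "\<lbrakk>x \<in> dual_cone C; y \<in> dual_cone C\<rbrakk> \<Longrightarrow> x + y \<in> dual_cone C"
  by (auto simp: dual_cone_def inner_simps)

lemma dual_cone_zero: "0 \<in> dual_cone C"
  by (simp add: dual_cone_def)

lemma chart_ring_add: "\<lbrakk>f \<in> chart_ring \<tau>; g \<in> chart_ring \<tau>\<rbrakk> \<Longrightarrow> f + g \<in> chart_ring \<tau>"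
  unfolding chart_ring_def by (rule character_span_add)

lemma chart_ring_mult: "\<lbrakk>f \<in> chart_ring \<tau>; g \<in> chart_ring \<tau>\<rbrakk> \<Longrightarrow> f * g \<in> chart_ring \<tau>"
  unfolding chart_ring_def by (rule character_span_mult[OF _ _ dual_cone_add])

lemma chart_ring_uminus: "f \<in> chart_ring \<tau> \<Longrightarrow> - f \<in> chart_ring \<tau>"
  unfolding chart_ring_def by (rule character_span_uminus)

lemma chart_ring_zero: "0 \<in> chart_ring \<tau>"
  unfolding chart_ring_def by (rule character_span_zero)

lemma monomial_in_chart_ring: "to_real_vec m \<in> dual_cone \<tau> \<Longrightarrow> monomial m \<in> chart_ring \<tau>"
  unfolding chart_ring_def by (rule monomial_in_character_span)

lemma const_in_chart_ring: "const_section c \<in> chart_ring \<tau>"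
  unfolding chart_ring_def by (rule const_in_character_span[OF dual_cone_zero])

lemma chart_ring_one: "1 \<in> chart_ring \<tau>"
  using const_in_chart_ring[of 1] by simp

section \<open>Points of a chart as local rings\<close>

lemma chart_ring_cring: "cring (ring_on (chart_ring \<tau>))"
proof (rule cringI)
  show "abelian_group (ring_on (chart_ring \<tau>))"
    by (rule abelian_groupI)
      (auto simp: ring_on_def chart_ring_add chart_ring_zero add_ac
        intro: bexI[OF _ chart_ring_uminus])
  show "Group.comm_monoid (ring_on (chart_ring \<tau>))"
    by (rule comm_monoidI) (auto simp: ring_on_def chart_ring_mult chart_ring_one mult_ac)
qed (auto simp: ring_on_def algebra_simps)

text \<open>Translates prime ideals of the record structure into closure conditions on sets of field
  elements; \<open>1 \<notin> \<pp>\<close> expresses properness.\<close>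

lemma primeideal_chart_ring_iff:
  "primeideal \<pp> (ring_on (chart_ring \<tau>)) \<longleftrightarrow>
     \<pp> \<subseteq> chart_ring \<tau> \<and> 0 \<in> \<pp> \<and> (\<forall>a\<in>\<pp>. \<forall>b\<in>\<pp>. a + b \<in> \<pp>) \<and>
     (\<forall>a\<in>\<pp>. \<forall>b\<in>chart_ring \<tau>. a * b \<in> \<pp>) \<and> 1 \<notin> \<pp> \<and>
     (\<forall>a\<in>chart_ring \<tau>. \<forall>b\<in>chart_ring \<tau>. a * b \<in> \<pp> \<longrightarrow> a \<in> \<pp> \<or> b \<in> \<pp>)" (is "?l \<longleftrightarrow> ?r")
proof
  assume ?l
  then interpret primeideal \<pp> "ring_on (chart_ring \<tau>)" .
  show ?r
    using a_subset additive_subgroup.zero_closed[OF is_additive_subgroup]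
      additive_subgroup.a_closed[OF is_additive_subgroup] I_r_closed I_prime
      one_imp_carrier I_notcarr
    by (auto simp: ring_on_def)
next
  assume r: ?r
  let ?R = "ring_on (chart_ring \<tau>)"
  interpret cring ?R by (rule chart_ring_cring)
  have neg: "- a \<in> \<pp>" if "a \<in> \<pp>" for a
    using r that chart_ring_uminus[OF chart_ring_one, of \<tau>] by (metis mult_minus1_right)
  have inv: "inv\<^bsub>add_monoid ?R\<^esub> a = - a" if "a \<in> chart_ring \<tau>" for a
    using that add.inv_equality[of "- a" a] by (simp add: ring_on_def chart_ring_uminus a_inv_def)
  have "subgroup \<pp> (add_monoid ?R)"
    by (rule subgroup.intro) (use r neg inv in \<open>auto simp: ring_on_def subset_iff\<close>)
  then have "ideal \<pp> ?R"
    by (rule idealI[OF ring_axioms]) (use r in \<open>auto simp: ring_on_def mult.commute\<close>)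
  then show ?l
    by (rule primeidealI[OF _ chart_ring_cring])
      (use r chart_ring_one[of \<tau>] in \<open>auto simp: ring_on_def\<close>)
qed

text \<open>The complement of a prime ideal is multiplicatively closed and avoids 0, so a
  localization is a ring that contains the chart ring. The criteria for sections use only this about
  points.\<close>

lemma
  assumes "x \<in> chart \<tau>"
  shows chart_ring_subset_point: "chart_ring \<tau> \<subseteq> x"
    and chart_point_add: "\<lbrakk>a \<in> x; b \<in> x\<rbrakk> \<Longrightarrow> a + b \<in> x"
    and chart_point_mult: "\<lbrakk>a \<in> x; b \<in> x\<rbrakk> \<Longrightarrow> a * b \<in> x"
proof -
  obtain \<pp> where x: "x = localization (chart_ring \<tau>) \<pp>"
    and "primeideal \<pp> (ring_on (chart_ring \<tau>))"
    using assms by (auto simp: chart_def spec_def)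
  then have p: "0 \<in> \<pp>" "1 \<notin> \<pp>"
      "\<And>a b. \<lbrakk>a \<in> chart_ring \<tau> - \<pp>; b \<in> chart_ring \<tau> - \<pp>\<rbrakk> \<Longrightarrow> a * b \<in> chart_ring \<tau> - \<pp>"
    unfolding primeideal_chart_ring_iff by (auto simp: chart_ring_mult)
  show "chart_ring \<tau> \<subseteq> x"
    unfolding x localization_def using p chart_ring_one[of \<tau>] by force
  assume "a \<in> x" "b \<in> x"
  then obtain c d e f where ab: "a = c / d" "b = e / f" and c: "c \<in> chart_ring \<tau>" "e \<in> chart_ring \<tau>"
    and d: "d \<in> chart_ring \<tau> - \<pp>" "f \<in> chart_ring \<tau> - \<pp>"
    unfolding x localization_def by auto
  have "a * b = (c * e) / (d * f)" by (simp add: ab)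
  then show "a * b \<in> x"
    unfolding x localization_def using p(3)[OF d] chart_ring_mult[OF c] by blast
  have "d \<noteq> 0" "f \<noteq> 0" using p d by auto
  then have "a + b = (c * f + e * d) / (d * f)" by (simp add: ab add_frac_eq)
  moreover have "c * f + e * d \<in> chart_ring \<tau>"
    using c d by (simp add: chart_ring_mult chart_ring_add)
  ultimately show "a + b \<in> x"
    unfolding x localization_def using p(3)[OF d] by blast
qed

lemma chart_point_const: "x \<in> chart \<tau> \<Longrightarrow> const_section c \<in> x"
  using chart_ring_subset_point const_in_chart_ring by blast

lemma chart_point_zero: "x \<in> chart \<tau> \<Longrightarrow> 0 \<in> x"
  using chart_point_const[of x \<tau> 0] by simp

lemma chart_point_one: "x \<in> chart \<tau> \<Longrightarrow> 1 \<in> x"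
  using chart_point_const[of x \<tau> 1] by simp

lemma chart_point_uminus: "\<lbrakk>x \<in> chart \<tau>; a \<in> x\<rbrakk> \<Longrightarrow> - a \<in> x"
  using chart_point_mult[of x \<tau> a "const_section (0 - 1)"] chart_point_const[of x \<tau> "0 - 1"]
  by (simp only: const_section_diff const_section_zero const_section_one) simp

lemma openin_chart:
  assumes "\<tau> \<in> \<Sigma>"
  shows "openin (toric_variety \<Sigma>) (chart \<tau>)"
proof -
  have "chart \<tau> = basic_open (chart_ring \<tau>) 1"
    unfolding chart_def spec_def basic_open_def using primeideal_chart_ring_iff by blast
  then show ?thesis
    unfolding toric_variety_def using assms chart_ring_one[of \<tau>]
    by (intro topology_generated_by_Basis) blast
qed

section \<open>The generic point\<close>

lemma large_ball_in_cone:
  fixes D :: "'n::finite real_space set"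
  assumes D: "\<And>x c. \<lbrakk>x \<in> D; 0 \<le> c\<rbrakk> \<Longrightarrow> c *\<^sub>R x \<in> D" and i: "interior D \<noteq> {}"
  obtains y where "ball y r \<subseteq> D"
proof -
  obtain z e where e: "0 < e" "ball z e \<subseteq> D"
    using i by (meson ex_in_conv mem_interior)
  \<comment> \<open>The ball of radius \<open>e\<close> is scaled by \<open>c\<close>. The summand 1
    keeps \<open>c\<close> positive for every \<open>r\<close>.\<close>
  define c where "c = \<bar>r\<bar> / e + 1"
  have c: "c > 0" "r \<le> c * e" using e by (auto simp: c_def distrib_right add_nonneg_pos)
  have "w \<in> D" if "w \<in> ball (c *\<^sub>R z) r" for w
  proof -
    have "dist z ((1 / c) *\<^sub>R w) = dist (c *\<^sub>R z) w / c"
    proof -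
      have "z - (1 / c) *\<^sub>R w = (1 / c) *\<^sub>R (c *\<^sub>R z - w)" using c by (simp add: scaleR_right_diff_distrib)
      then show ?thesis unfolding dist_norm using c by simp
    qed
    also have "\<dots> < e" using that c by (simp add: field_simps)
    finally have "(1 / c) *\<^sub>R w \<in> D" using e by auto
    then have "c *\<^sub>R ((1 / c) *\<^sub>R w) \<in> D" using D[OF _ less_imp_le[OF c(1)]] by blast
    then show ?thesis using c by simp
  qed
  then show thesis using that by blast
qed

text \<open>Rounding down changes each coordinate by at most 1, and the Euclidean norm is bounded by
  the sum of the absolute values of the coordinates.\<close>

lemma lattice_point_near:
  fixes y :: "'n::finite real_space"
  obtains m where "dist y (to_real_vec m) \<le> real CARD('n)"
proof -
  define m :: "'n lattice" where "m = Abs_poly_mapping (\<lambda>i. \<lfloor>y $ i\<rfloor>)"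
  have m: "to_real_vec m = (\<chi> i. of_int \<lfloor>y $ i\<rfloor>)"
    by (simp add: to_real_vec_def m_def Abs_poly_mapping_inverse)
  have "dist y (to_real_vec m) \<le> (\<Sum>i\<in>UNIV. \<bar>(y - to_real_vec m) $ i\<bar>)"
    unfolding dist_norm by (rule norm_le_l1_cart)
  also have "\<dots> \<le> (\<Sum>i\<in>(UNIV::'n set). 1)"
  proof (rule sum_mono)
    fix i
    show "\<bar>(y - to_real_vec m) $ i\<bar> \<le> 1"
      unfolding m vector_minus_component vec_lambda_beta by linarith
  qed
  finally show thesis using that by simp
qed

text \<open>
  The generic point lies on every chart: a full-dimensional \<open>\<tau>\<^sup>\<or>\<close> contains a translate of any
  finite set of characters, so \<open>\<complex>[\<tau>\<^sup>\<or> \<inter> M]\<close> has the same fractions as \<open>\<complex>[M]\<close>.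
\<close>

lemma generic_point_in_chart:
  fixes \<tau> :: "'n::{finite,linorder} real_space set"
  assumes i: "interior (dual_cone \<tau>) \<noteq> {}"
  shows "UNIV \<in> chart \<tau>"
proof -
  have shift: "\<exists>u. monomial u * to_fract f \<in> chart_ring \<tau> \<and> monomial u * to_fract g \<in> chart_ring \<tau>"
    for f g :: "'n laurent"
  proof -
    let ?S = "Poly_Mapping.keys f \<union> Poly_Mapping.keys g"
    \<comment> \<open>Room for the rounding error between \<open>y\<close> and \<open>u\<close>, for
      the translation by any character that occurs, and 1 more because the ball is open.\<close>
    define r where "r = real CARD('n) + (\<Sum>m\<in>?S. norm (to_real_vec m)) + 1"
    obtain y where y: "ball y r \<subseteq> dual_cone \<tau>"
      using large_ball_in_cone[OF _ i] by (auto simp: dual_cone_def)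
    obtain u where u: "dist y (to_real_vec u) \<le> real CARD('n)" by (rule lattice_point_near)
    have "to_real_vec u + to_real_vec m \<in> dual_cone \<tau>" if "m \<in> ?S" for m
    proof -
      have "norm (to_real_vec m) \<le> (\<Sum>m\<in>?S. norm (to_real_vec m))"
        using that by (intro member_le_sum) auto
      moreover have "dist y (to_real_vec u + to_real_vec m) \<le> dist y (to_real_vec u) + norm (to_real_vec m)"
        using norm_triangle_ineq4[of "y - to_real_vec u" "to_real_vec m"] by (simp add: dist_norm diff_diff_add)
      ultimately have "to_real_vec u + to_real_vec m \<in> ball y r" using u by (simp add: r_def)
      then show ?thesis using y by blast
    qed
    moreover have "monomial u * to_fract h \<in> chart_ring \<tau>"
      if h: "\<And>m. m \<in> Poly_Mapping.keys h \<Longrightarrow> to_real_vec u + to_real_vec m \<in> dual_cone \<tau>" for h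
      unfolding chart_ring_def
    proof (rule character_span_mult)
      show "monomial u \<in> character_span {to_real_vec u}" by (simp add: monomial_in_character_span)
      show "to_fract h \<in> character_span (to_real_vec ` Poly_Mapping.keys h)"
        unfolding character_span_def by auto
    qed (use h in auto)
    ultimately show ?thesis by blast
  qed
  \<comment> \<open>The generic point is the localization at the zero ideal. Multiplying numerator
    and denominator by one monomial moves both into the chart ring, so this is the whole
    field.\<close>
  have "q \<in> localization (chart_ring \<tau>) {0}" for q
  proof -
    obtain f g where q: "q = Fract f g" "g \<noteq> 0" by (cases q) auto
    obtain u where u: "monomial u * to_fract f \<in> chart_ring \<tau>" "monomial u * to_fract g \<in> chart_ring \<tau>"
      using shift by blast
    have u0: "monomial u \<noteq> 0" using monomial_mult_uminus[of u] by (metis mult_zero_left zero_neq_one)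
    then have "q = (monomial u * to_fract f) / (monomial u * to_fract g)"
      by (simp add: q Fract_conv_to_fract)
    moreover have "monomial u * to_fract g \<noteq> 0" using u0 q by simp
    ultimately show ?thesis unfolding localization_def using u by blast
  qed
  moreover have "primeideal {0} (ring_on (chart_ring \<tau>))"
    unfolding primeideal_chart_ring_iff by (simp add: chart_ring_zero)
  ultimately show ?thesis
    unfolding chart_def spec_def by blast
qed

text \<open>For \<open>z\<close> in the face that defines \<tau>, the translate of \<Delta> by
  \<open>- z\<close> lies in the dual cone and is full-dimensional.\<close>

lemma dual_normal_cone_interior:
  fixes \<Delta> :: "'n::finite real_space set"
  assumes "\<tau> \<in> normal_fan \<Delta>" "convex \<Delta>" "aff_dim \<Delta> = int CARD('n)"
  shows "interior (dual_cone \<tau>) \<noteq> {}"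
proof -
  obtain F z where \<tau>: "\<tau> = normal_cone \<Delta> F" and z: "z \<in> F" "F \<subseteq> \<Delta>"
    using assms by (auto simp: normal_fan_def dest: face_of_imp_subset)
  have "interior \<Delta> \<noteq> {}"
    using assms z rel_interior_eq_empty[of \<Delta>] by (auto simp: interior_rel_interior_gen)
  moreover have "(\<lambda>y. - z + y) ` \<Delta> \<subseteq> dual_cone \<tau>"
    using z by (auto simp: dual_cone_def \<tau> normal_cone_def inner_simps)
  ultimately show ?thesis
    using interior_mono interior_translation by (metis image_is_empty subset_empty)
qed

section \<open>The torus action\<close>

text \<open>Additive induction: a Laurent polynomial is a sum of single terms, so multiplicativity
  of the torus action need only be checked on those.\<close>

lemma laurent_induct [case_names single add]:
  fixes f :: "'a \<Rightarrow>\<^sub>0 'b::comm_monoid_add"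
  assumes "\<And>m c. P (Poly_Mapping.single m c)" and "\<And>f g. \<lbrakk>P f; P g\<rbrakk> \<Longrightarrow> P (f + g)"
  shows "P f"
proof (induction f rule: update_induct)
  case const
  show ?case using assms(1)[of undefined 0] by simp
next
  case (update f a b)
  then have "Poly_Mapping.update a b f = Poly_Mapping.single a b + f"
    by (intro poly_mapping_eqI) (auto simp: lookup_update lookup_add lookup_single when_def in_keys_iff)
  then show ?case using assms update by metis
qed

lemma torus_nonzero: "t \<in> torus \<Longrightarrow> t m \<noteq> 0"
  unfolding torus_def by (metis (mono_tags, lifting) add.right_inverse mem_Collect_eq mult_zero_left zero_neq_one)

lemma lookup_torus_act_laurent:
  "Poly_Mapping.lookup (torus_act_laurent t f) m = t m * Poly_Mapping.lookup f m"
  by (simp add: torus_act_laurent_def lookup_mapp when_def in_keys_iff)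

lemma torus_act_laurent_add: "torus_act_laurent t (f + g) = torus_act_laurent t f + torus_act_laurent t g"
  by (rule poly_mapping_eqI) (simp add: lookup_torus_act_laurent lookup_add algebra_simps)

lemma torus_act_laurent_single:
  "torus_act_laurent t (Poly_Mapping.single m c) = Poly_Mapping.single m (t m * c)"
  by (rule poly_mapping_eqI) (simp add: lookup_torus_act_laurent lookup_single when_def)

lemma torus_act_laurent_mult:
  assumes t: "t \<in> torus"
  shows "torus_act_laurent t (f * g) = torus_act_laurent t f * torus_act_laurent t g"
proof (induction f rule: laurent_induct)
  case (single m c)
  show ?case
  proof (induction g rule: laurent_induct)
    case (single m' c')
    then show ?case using t by (simp add: mult_single torus_act_laurent_single torus_def mult_ac)
  qed (simp add: torus_act_laurent_add distrib_left)
qed (simp add: torus_act_laurent_add distrib_right)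

lemma torus_act_laurent_one: "t \<in> torus \<Longrightarrow> torus_act_laurent t 1 = 1"
  using torus_act_laurent_single[of t 0 1] by (simp add: torus_def)

lemma torus_act_laurent_eq_0_iff: "t \<in> torus \<Longrightarrow> torus_act_laurent t f = 0 \<longleftrightarrow> f = 0"
  by (simp add: poly_mapping_eq_iff fun_eq_iff lookup_torus_act_laurent torus_nonzero)

lemma keys_torus_act_laurent:
  "t \<in> torus \<Longrightarrow> Poly_Mapping.keys (torus_act_laurent t f) = Poly_Mapping.keys f"
  by (auto simp: in_keys_iff lookup_torus_act_laurent torus_nonzero)

text \<open>The action on Laurent polynomials is multiplicative and injective, so the description in
  \<open>torus_act\<close> does not depend on the chosen fraction.\<close>

lemma torus_act_Fract:
  assumes t: "t \<in> torus" and b: "b \<noteq> 0"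
  shows "torus_act t (Fract a b) = Fract (torus_act_laurent t a) (torus_act_laurent t b)"
  unfolding torus_act_def
proof (rule the_equality)
  show "\<exists>c d. d \<noteq> 0 \<and> Fract a b = Fract c d \<and>
      Fract (torus_act_laurent t a) (torus_act_laurent t b)
        = Fract (torus_act_laurent t c) (torus_act_laurent t d)"
    using b by blast
next
  fix r assume "\<exists>c d. d \<noteq> 0 \<and> Fract a b = Fract c d \<and>
      r = Fract (torus_act_laurent t c) (torus_act_laurent t d)"
  then obtain c d where cd: "d \<noteq> 0" "a * d = c * b"
    and r: "r = Fract (torus_act_laurent t c) (torus_act_laurent t d)"
    using b by (auto simp: eq_fract)
  have "torus_act_laurent t a * torus_act_laurent t d = torus_act_laurent t c * torus_act_laurent t b"
    using cd t by (metis torus_act_laurent_mult)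
  then show "r = Fract (torus_act_laurent t a) (torus_act_laurent t b)"
    using r cd b t by (simp add: eq_fract torus_act_laurent_eq_0_iff)
qed

context
  fixes t :: "'n::{finite,linorder} lattice \<Rightarrow> complex"
  assumes t: "t \<in> torus"
begin

lemma torus_act_to_fract: "torus_act t (to_fract f) = to_fract (torus_act_laurent t f)"
  by (simp add: to_fract_def torus_act_Fract t torus_act_laurent_one)

lemma torus_act_add: "torus_act t (p + q) = torus_act t p + torus_act t q"
  by (cases p; cases q)
    (simp add: torus_act_Fract t torus_act_laurent_mult torus_act_laurent_add torus_act_laurent_eq_0_iff)

lemma torus_act_mult: "torus_act t (p * q) = torus_act t p * torus_act t q"
  by (cases p; cases q) (simp add: torus_act_Fract t torus_act_laurent_mult)

lemma torus_act_zero: "torus_act t 0 = 0"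
  using torus_act_add[of 0 0] by (metis add.right_neutral add_left_cancel)

lemma torus_act_one: "torus_act t 1 = 1"
  using torus_act_to_fract[of 1] by (simp add: torus_act_laurent_one t)

lemma torus_act_uminus: "torus_act t (- p) = - torus_act t p"
  using torus_act_add[of p "- p"] by (simp add: torus_act_zero eq_neg_iff_add_eq_0 add.commute)

lemma torus_act_divide: "torus_act t (p / q) = torus_act t p / torus_act t q"
proof (cases "q = 0")
  case False
  then have "torus_act t (p / q) * torus_act t q = torus_act t p"
    by (simp flip: torus_act_mult)
  moreover have "torus_act t q \<noteq> 0"
    using False torus_act_mult[of q "1 / q"] by (auto simp: torus_act_one)
  ultimately show ?thesis by (simp add: field_simps)
qed (simp add: torus_act_zero)

lemma torus_inverse: "(\<lambda>m. t (- m)) \<in> torus"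
  unfolding torus_def
proof (intro CollectI conjI allI)
  show "t (- (m + m')) = t (- m) * t (- m')" for m m'
    using t unfolding torus_def minus_add_distrib by blast
qed (use t in \<open>simp add: torus_def\<close>)

lemma torus_act_character_span: "f \<in> character_span S \<Longrightarrow> torus_act t f \<in> character_span S"
  unfolding character_span_def by (auto simp: torus_act_to_fract keys_torus_act_laurent t)

end

lemma torus_act_inverse:
  assumes t: "t \<in> torus"
  shows "torus_act (\<lambda>m. t (- m)) (torus_act t q) = q" "torus_act t (torus_act (\<lambda>m. t (- m)) q) = q"
proof -
  have eq: "t m * t (- m) = 1" "t (- m) * t m = 1" for m
    using t unfolding torus_def by (metis (mono_tags, lifting) add.right_inverse add.left_inverse mem_Collect_eq)+
  have "torus_act_laurent (\<lambda>m. t (- m)) (torus_act_laurent t f) = f" for f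
    by (rule poly_mapping_eqI) (simp add: lookup_torus_act_laurent eq flip: mult.assoc)
  moreover have "torus_act_laurent t (torus_act_laurent (\<lambda>m. t (- m)) f) = f" for f
    by (rule poly_mapping_eqI) (simp add: lookup_torus_act_laurent eq flip: mult.assoc)
  ultimately show "torus_act (\<lambda>m. t (- m)) (torus_act t q) = q" "torus_act t (torus_act (\<lambda>m. t (- m)) q) = q"
    by (cases q; simp add: torus_act_Fract t torus_inverse torus_act_laurent_eq_0_iff)+
qed

text \<open>The torus rescales characters and hence acts on the chart ring by automorphisms. The
  localization at \<pp> goes to the localization at the image of \<pp>, which \<open>\<qq>\<close>
  describes as a preimage under the inverse element.\<close>

lemma torus_act_chart:
  assumes t: "t \<in> torus" and x: "x \<in> chart \<tau>"
  shows "torus_act t ` x \<in> chart \<tau>"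
proof -
  let ?A = "chart_ring \<tau>" and ?t = "torus_act t" and ?s = "torus_act (\<lambda>m. t (- m))"
  note s = torus_inverse[OF t]
  obtain \<pp> where x: "x = localization ?A \<pp>" and p: "primeideal \<pp> (ring_on ?A)"
    using x by (auto simp: chart_def spec_def)
  have tA: "?t a \<in> ?A" if "a \<in> ?A" for a
    using that torus_act_character_span[OF t] by (simp add: chart_ring_def)
  have sA: "?s a \<in> ?A" if "a \<in> ?A" for a
    using that torus_act_character_span[OF s] by (simp add: chart_ring_def)
  note st = torus_act_inverse[OF t]
  define \<qq> where "\<qq> = {a \<in> ?A. ?s a \<in> \<pp>}"
  have "primeideal \<qq> (ring_on ?A)"
    using p unfolding primeideal_chart_ring_iff \<qq>_def
    by (auto simp: torus_act_add[OF s] torus_act_mult[OF s] torus_act_zero[OF s] torus_act_one[OF s]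
        chart_ring_zero chart_ring_add chart_ring_mult sA)
  moreover have "?t ` x = localization ?A \<qq>"
  proof
    show "?t ` x \<subseteq> localization ?A \<qq>"
    proof
      fix q assume "q \<in> ?t ` x"
      then obtain a b where "q = ?t (a / b)" and ab: "a \<in> ?A" "b \<in> ?A - \<pp>"
        unfolding x localization_def by blast
      then have "q = ?t a / ?t b" by (simp add: torus_act_divide[OF t])
      moreover have "?t a \<in> ?A" "?t b \<in> ?A - \<qq>" using ab tA by (auto simp: \<qq>_def st)
      ultimately show "q \<in> localization ?A \<qq>" unfolding localization_def by blast
    qed
    show "localization ?A \<qq> \<subseteq> ?t ` x"
    proof
      fix q assume "q \<in> localization ?A \<qq>"
      then obtain a b where q: "q = a / b" and ab: "a \<in> ?A" "b \<in> ?A - \<qq>"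
        unfolding localization_def by blast
      then have "q = ?t (?s a / ?s b)" by (simp add: torus_act_divide[OF t] st)
      moreover have "?s a \<in> ?A" "?s b \<in> ?A - \<pp>" using ab sA by (auto simp: \<qq>_def)
      ultimately show "q \<in> ?t ` x" unfolding x localization_def by blast
    qed
  qed
  ultimately show ?thesis unfolding chart_def spec_def by blast
qed

lemma equivariant_toric_sheaf: "equivariant_sheaf X torus_act (toric_sheaf \<Sigma> P)"
proof -
  have sub: "torus_act t ` toric_sheaf \<Sigma> P V \<subseteq> toric_sheaf \<Sigma> P ((\<lambda>x. torus_act t ` x) ` V)"
    if t: "t \<in> torus" for t V
  proof
    fix s' assume "s' \<in> torus_act t ` toric_sheaf \<Sigma> P V"
    then obtain s where s': "s' = torus_act t s" and s: "s \<in> toric_sheaf \<Sigma> P V" by blast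
    show "s' \<in> toric_sheaf \<Sigma> P ((\<lambda>x. torus_act t ` x) ` V)"
    proof (cases "V = {}")
      case True
      then show ?thesis using s s' by (simp add: toric_sheaf_def torus_act_zero[OF t])
    next
      case False
      have "\<exists>\<tau>\<in>\<Sigma>. torus_act t ` x \<in> chart \<tau> \<and>
          (\<exists>u\<in>torus_act t ` x. \<exists>g\<in>character_span (P + dual_cone \<tau>). s' = u * g)" if x: "x \<in> V" for x
      proof -
        have "\<exists>\<tau>\<in>\<Sigma>. x \<in> chart \<tau> \<and> (\<exists>u\<in>x. \<exists>g\<in>character_span (P + dual_cone \<tau>). s = u * g)"
          using s False x by (simp add: toric_sheaf_def)
        then obtain \<tau> u g where "\<tau> \<in> \<Sigma>" "x \<in> chart \<tau>" "u \<in> x" "g \<in> character_span (P + dual_cone \<tau>)" "s = u * g"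
          by blast
        then show ?thesis
          using torus_act_chart[OF t] torus_act_character_span[OF t] torus_act_mult[OF t] s' by blast
      qed
      then show ?thesis using False by (auto simp: toric_sheaf_def)
    qed
  qed
  show ?thesis
    unfolding equivariant_sheaf_def
  proof (intro ballI allI impI equalityI)
    fix t :: "'a lattice \<Rightarrow> complex" and V assume t: "t \<in> torus"
    \<comment> \<open>The inclusion \<open>sub\<close>, applied to the inverse torus element and
      transported back by \<open>t\<close>, gives the opposite inclusion.\<close>
    let ?s = "\<lambda>m. t (- m)" and ?tV = "(\<lambda>x. torus_act t ` x) ` V"
    have "(\<lambda>x. torus_act ?s ` x) ` ?tV = V"
      by (simp add: image_image torus_act_inverse[OF t])
    then have "torus_act ?s ` toric_sheaf \<Sigma> P ?tV \<subseteq> toric_sheaf \<Sigma> P V"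
      using sub[OF torus_inverse[OF t], of ?tV] by simp
    then have "torus_act t ` torus_act ?s ` toric_sheaf \<Sigma> P ?tV \<subseteq> torus_act t ` toric_sheaf \<Sigma> P V"
      by (rule image_mono)
    then show "toric_sheaf \<Sigma> P ?tV \<subseteq> torus_act t ` toric_sheaf \<Sigma> P V"
      by (simp add: image_image torus_act_inverse[OF t])
    show "torus_act t ` toric_sheaf \<Sigma> P V \<subseteq> toric_sheaf \<Sigma> P ?tV" by (rule sub[OF t])
  qed
qed

lemma equivariant_direct_sum:
  assumes "equivariant_sheaf X torus_act F" "equivariant_sheaf X torus_act G"
  shows "equivariant_sheaf X torus_act_pair (direct_sum F G)"
  using assms unfolding equivariant_sheaf_def direct_sum_def torus_act_pair_def
  by (simp add: map_prod_surj_on map_prod_def image_paired_Times)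

lemma equivariant_antidiagonal: "equivariant_map torus_act torus_act_pair (\<lambda>s. (- s, s))"
  by (simp add: equivariant_map_def torus_act_pair_def torus_act_uminus)

lemma equivariant_pair_add: "equivariant_map torus_act_pair torus_act (\<lambda>(a, b). a + b)"
  by (auto simp: equivariant_map_def torus_act_pair_def torus_act_add)

section \<open>Sections over a chart\<close>

text \<open>Equivalently, \<open>m\<close> lies in \<open>P\<close> and
  \<open>P + dual_cone \<tau>\<close> is the translate of \<open>dual_cone \<tau>\<close> by
  \<open>m\<close>.\<close>

definition minimal_at :: "'n::finite real_space set \<Rightarrow> 'n real_space set \<Rightarrow> 'n lattice \<Rightarrow> bool" where
  "minimal_at P \<tau> m \<longleftrightarrow> to_real_vec m \<in> P \<and> (\<forall>v\<in>\<tau>. \<forall>y\<in>P. v \<bullet> to_real_vec m \<le> v \<bullet> y)"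

lemma minimal_atD: "minimal_at P \<tau> m \<Longrightarrow> y \<in> P \<Longrightarrow> y - to_real_vec m \<in> dual_cone \<tau>"
  by (simp add: minimal_at_def dual_cone_def inner_simps)

lemma monomial_in_point:
  assumes "x \<in> chart \<tau>" "minimal_at P \<tau> m" "to_real_vec m' \<in> P"
  shows "monomial (m' - m) \<in> x"
  using assms chart_ring_subset_point minimal_atD[OF assms(2,3)] monomial_in_chart_ring[of "m' - m" \<tau>]
  by (auto simp: to_real_vec_diff)

text \<open>The module is the monomial of \<open>m\<close> times the chart ring, so its localization
  is that monomial times the local ring \<open>x\<close>.\<close>

lemma module_generator:
  assumes x: "x \<in> chart \<tau>" and m: "minimal_at P \<tau> m"
  shows "(\<exists>u\<in>x. \<exists>g\<in>character_span (P + dual_cone \<tau>). s = u * g) \<longleftrightarrow> s * monomial (- m) \<in> x"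
proof
  assume "\<exists>u\<in>x. \<exists>g\<in>character_span (P + dual_cone \<tau>). s = u * g"
  then obtain u g where u: "u \<in> x" and g: "g \<in> character_span (P + dual_cone \<tau>)" and s: "s = u * g"
    by blast
  have "monomial (- m) * g \<in> character_span (dual_cone \<tau>)"
  proof (rule character_span_mult)
    show "monomial (- m) \<in> character_span {- to_real_vec m}"
      by (simp add: monomial_in_character_span to_real_vec_uminus)
    fix y z assume "y \<in> {- to_real_vec m}" "z \<in> P + dual_cone \<tau>"
    then obtain p d where "y = - to_real_vec m" "z = p + d" "p \<in> P" "d \<in> dual_cone \<tau>"
      by (auto simp: set_plus_def)
    then show "y + z \<in> dual_cone \<tau>"
      using dual_cone_add[OF minimal_atD[OF m], of p d] by (simp add: algebra_simps)
  qed (rule g)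
  then have "u * (monomial (- m) * g) \<in> x"
    using u x chart_point_mult chart_ring_subset_point unfolding chart_ring_def by blast
  then show "s * monomial (- m) \<in> x" by (simp add: s mult_ac)
next
  assume *: "s * monomial (- m) \<in> x"
  have "monomial m \<in> character_span (P + dual_cone \<tau>)"
    using m dual_cone_zero[of \<tau>] by (force intro: monomial_in_character_span simp: minimal_at_def set_plus_def)
  moreover have "s = (s * monomial (- m)) * monomial m" by (simp add: mult.assoc)
  ultimately show "\<exists>u\<in>x. \<exists>g\<in>character_span (P + dual_cone \<tau>). s = u * g" using * by blast
qed

text \<open>What the sheaf computations take from a member of \<open>Pol_plus\<close>: a local
  generator on every chart. In this form the unions of a component with \<open>\<Delta>p\<close> are
  treated like \<open>\<Delta>p\<close> and \<open>\<Delta>m\<close>.\<close>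

definition has_vertices :: "'n::finite real_space set set \<Rightarrow> 'n real_space set \<Rightarrow> bool" where
  "has_vertices \<Sigma> P \<longleftrightarrow> (\<forall>\<tau>\<in>\<Sigma>. \<exists>m. minimal_at P \<tau> m)"

lemma Pol_plus_has_vertices:
  assumes "P \<in> Pol_plus (normal_fan \<Delta>)" "P \<noteq> {}"
  shows "has_vertices (normal_fan \<Delta>) P"
  unfolding has_vertices_def
proof
  fix \<tau> assume \<tau>: "\<tau> \<in> normal_fan \<Delta>"
  then have "convex \<tau>" "\<tau> \<noteq> {}"
    using convex_normal_cone zero_in_normal_cone unfolding normal_fan_def by blast+
  then show "\<exists>m. minimal_at P \<tau> m"
    using Pol_plus_vertex[OF assms \<tau>] unfolding minimal_at_def by metis
qed

text \<open>
  Two generators of the stalk that come from different charts differ by a unit: each of them is a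
  lattice point of \<open>P\<close>, hence a multiple of the other one.
\<close>

lemma generator_change:
  assumes "x \<in> chart \<tau>" "x \<in> chart \<tau>'" "minimal_at P \<tau> m" "minimal_at P \<tau>' m'"
    and s: "s * monomial (- m') \<in> x"
  shows "s * monomial (- m) \<in> x"
proof -
  have "monomial (m' - m) \<in> x"
    using monomial_in_point[of x \<tau> P m m'] assms by (simp add: minimal_at_def)
  then have "s * monomial (- m') * monomial (m' - m) \<in> x"
    using chart_point_mult[OF assms(1) s] by blast
  then show ?thesis by (simp add: mult.assoc flip: monomial_add)
qed

text \<open>The definition allows a different cone at every point; by
  \<open>generator_change\<close> the generator of one fixed chart serves for all of them.\<close>

lemma toric_sheaf_iff:
  assumes P: "has_vertices \<Sigma> P" and \<tau>: "\<tau> \<in> \<Sigma>" "minimal_at P \<tau> m"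
    and V: "V \<subseteq> chart \<tau>" "V \<noteq> {}"
  shows "s \<in> toric_sheaf \<Sigma> P V \<longleftrightarrow> (\<forall>x\<in>V. s * monomial (- m) \<in> x)"
proof -
  have "(\<exists>\<tau>'\<in>\<Sigma>. x \<in> chart \<tau>' \<and> (\<exists>u\<in>x. \<exists>g\<in>character_span (P + dual_cone \<tau>'). s = u * g))
      \<longleftrightarrow> s * monomial (- m) \<in> x" if x: "x \<in> V" for x
  proof
    assume "\<exists>\<tau>'\<in>\<Sigma>. x \<in> chart \<tau>' \<and> (\<exists>u\<in>x. \<exists>g\<in>character_span (P + dual_cone \<tau>'). s = u * g)"
    then obtain \<tau>' where \<tau>': "\<tau>' \<in> \<Sigma>" "x \<in> chart \<tau>'"
      and s: "\<exists>u\<in>x. \<exists>g\<in>character_span (P + dual_cone \<tau>'). s = u * g" by blast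
    obtain m' where "minimal_at P \<tau>' m'" using P \<tau>' by (auto simp: has_vertices_def)
    then show "s * monomial (- m) \<in> x"
      using generator_change[OF _ \<tau>'(2) \<tau>(2)] s module_generator[OF \<tau>'(2)] x V by blast
  next
    assume "s * monomial (- m) \<in> x"
    then show "\<exists>\<tau>'\<in>\<Sigma>. x \<in> chart \<tau>' \<and> (\<exists>u\<in>x. \<exists>g\<in>character_span (P + dual_cone \<tau>'). s = u * g)"
      using module_generator[OF _ \<tau>(2)] x V \<tau>(1) by blast
  qed
  then show ?thesis using V by (simp add: toric_sheaf_def)
qed

text \<open>Sections over \<open>{x}\<close> serve as notation for the stalk condition at
  \<open>x\<close>; the set \<open>{x}\<close> need not be open.\<close>

lemma toric_sheaf_local:
  assumes "V \<noteq> {}"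
  shows "s \<in> toric_sheaf \<Sigma> P V \<longleftrightarrow> (\<forall>x\<in>V. s \<in> toric_sheaf \<Sigma> P {x})"
  using assms by (simp add: toric_sheaf_def)

lemma toric_sheaf_in_chart:
  assumes "s \<in> toric_sheaf \<Sigma> P V" "x \<in> V"
  obtains \<tau> where "\<tau> \<in> \<Sigma>" "x \<in> chart \<tau>"
  using assms by (auto simp: toric_sheaf_def split: if_splits)

lemma toric_sheaf_mono: "P \<subseteq> Q \<Longrightarrow> toric_sheaf \<Sigma> P V \<subseteq> toric_sheaf \<Sigma> Q V"
proof
  fix s assume PQ: "P \<subseteq> Q" and s: "s \<in> toric_sheaf \<Sigma> P V"
  have sub: "character_span (P + dual_cone \<tau>) \<subseteq> character_span (Q + dual_cone \<tau>)" for \<tau>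
    using PQ unfolding character_span_def by (intro image_mono) (force simp: set_plus_def)
  show "s \<in> toric_sheaf \<Sigma> Q V"
  proof (cases "V = {}")
    case False
    then have "\<forall>x\<in>V. \<exists>\<tau>\<in>\<Sigma>. x \<in> chart \<tau> \<and> (\<exists>u\<in>x. \<exists>g\<in>character_span (P + dual_cone \<tau>). s = u * g)"
      using s by (simp add: toric_sheaf_def)
    then have "\<forall>x\<in>V. \<exists>\<tau>\<in>\<Sigma>. x \<in> chart \<tau> \<and> (\<exists>u\<in>x. \<exists>g\<in>character_span (Q + dual_cone \<tau>). s = u * g)"
      using sub by (meson subsetD)
    then show ?thesis using False by (simp add: toric_sheaf_def)
  qed (use s in \<open>simp add: toric_sheaf_def\<close>)
qed

lemma toric_sheaf_uminus:
  assumes s: "s \<in> toric_sheaf \<Sigma> P V"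
  shows "- s \<in> toric_sheaf \<Sigma> P V"
proof (cases "V = {}")
  case False
  have "\<exists>\<tau>\<in>\<Sigma>. x \<in> chart \<tau> \<and> (\<exists>u\<in>x. \<exists>g\<in>character_span (P + dual_cone \<tau>). - s = u * g)"
    if x: "x \<in> V" for x
  proof -
    have "\<exists>\<tau>\<in>\<Sigma>. x \<in> chart \<tau> \<and> (\<exists>u\<in>x. \<exists>g\<in>character_span (P + dual_cone \<tau>). s = u * g)"
      using s False x by (simp add: toric_sheaf_def)
    then obtain \<tau> u g where "\<tau> \<in> \<Sigma>" "x \<in> chart \<tau>" "u \<in> x"
      and "- g \<in> character_span (P + dual_cone \<tau>)" "s = u * g"
      using character_span_uminus by blast
    then show ?thesis by (metis minus_mult_right)
  qed
  then show ?thesis using False by (simp add: toric_sheaf_def)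
qed (use s in \<open>simp add: toric_sheaf_def\<close>)

lemma toric_sheaf_add:
  assumes P: "has_vertices \<Sigma> P" and s: "s \<in> toric_sheaf \<Sigma> P V" and t: "t \<in> toric_sheaf \<Sigma> P V"
  shows "s + t \<in> toric_sheaf \<Sigma> P V"
proof (cases "V = {}")
  case False
  have "s + t \<in> toric_sheaf \<Sigma> P {x}" if x: "x \<in> V" for x
  proof -
    obtain \<tau> where \<tau>: "\<tau> \<in> \<Sigma>" "x \<in> chart \<tau>" using toric_sheaf_in_chart[OF s x] .
    obtain m where "minimal_at P \<tau> m" using P \<tau> by (auto simp: has_vertices_def)
    note iff = toric_sheaf_iff[OF P \<tau>(1) this, of "{x}"]
    have "s \<in> toric_sheaf \<Sigma> P {x}" "t \<in> toric_sheaf \<Sigma> P {x}"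
      using s t x toric_sheaf_local[OF False] by blast+
    then show ?thesis using iff \<tau>(2) chart_point_add[OF \<tau>(2)] by (simp add: distrib_right)
  qed
  then show ?thesis using toric_sheaf_local[OF False] by blast
qed (use s t in \<open>simp add: toric_sheaf_def\<close>)

text \<open>A homomorphism on an invertible sheaf is determined by its value on a generator, here
  the monomial of \<open>m\<close>, and that value must be regular.\<close>

lemma inverse_sheaf_iff:
  assumes Q: "has_vertices \<Sigma> Q" and \<tau>: "\<tau> \<in> \<Sigma>" "minimal_at Q \<tau> m"
    and V: "openin (toric_variety \<Sigma>) V" "V \<subseteq> chart \<tau>" "V \<noteq> {}"
  shows "t \<in> inverse_sheaf (toric_variety \<Sigma>) (toric_sheaf \<Sigma> Q) V \<longleftrightarrow> (\<forall>x\<in>V. t * monomial m \<in> x)"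
proof
  assume t: "t \<in> inverse_sheaf (toric_variety \<Sigma>) (toric_sheaf \<Sigma> Q) V"
  have "monomial m \<in> toric_sheaf \<Sigma> Q V"
    using toric_sheaf_iff[OF Q \<tau> V(2,3)] chart_point_one[of _ \<tau>] V(2) by (simp add: subset_eq)
  then have "t * monomial m \<in> structure_sheaf V"
    using t V by (simp add: inverse_sheaf_def)
  then show "\<forall>x\<in>V. t * monomial m \<in> x" using V by (simp add: structure_sheaf_def)
next
  assume t: "\<forall>x\<in>V. t * monomial m \<in> x"
  have "t * s \<in> structure_sheaf W" if W: "W \<subseteq> V" and s: "s \<in> toric_sheaf \<Sigma> Q W" for W s
  proof (cases "W = {}")
    case True
    then show ?thesis using s by (simp add: toric_sheaf_def structure_sheaf_def)
  next
    case False
    have "t * s \<in> x" if x: "x \<in> W" for x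
    proof -
      have "s * monomial (- m) \<in> x"
        using toric_sheaf_iff[OF Q \<tau> _ False] s x W V by blast
      then have "(t * monomial m) * (s * monomial (- m)) \<in> x"
        using t x W V chart_point_mult[of x \<tau>] by blast
      moreover have "(t * monomial m) * (s * monomial (- m)) = t * s * (monomial m * monomial (- m))"
        by (simp add: mult_ac)
      ultimately show ?thesis by simp
    qed
    then show ?thesis using False by (simp add: structure_sheaf_def)
  qed
  then show "t \<in> inverse_sheaf (toric_variety \<Sigma>) (toric_sheaf \<Sigma> Q) V"
    using V by (simp add: inverse_sheaf_def)
qed

lemma chart_point_sum:
  "\<lbrakk>x \<in> chart \<tau>; \<And>i. i \<in> I \<Longrightarrow> h i \<in> x\<rbrakk> \<Longrightarrow> sum h I \<in> x"
  by (induction I rule: infinite_finite_induct) (auto intro: chart_point_zero chart_point_add)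

lemma tensor_sheafI:
  assumes "openin X V" "V \<noteq> {}" "a \<in> F V" "b \<in> G V"
  shows "sm b a \<in> tensor_sheaf sm X F G V"
proof -
  have "\<exists>(r::nat) a' b'. (\<forall>i<r. a' i \<in> F V \<and> b' i \<in> G V) \<and> sm b a = (\<Sum>i<r. sm (b' i) (a' i))"
    using assms by (intro exI[of _ 1] exI[of _ "\<lambda>_. a"] exI[of _ "\<lambda>_. b"]) simp
  then show ?thesis
    unfolding tensor_sheaf_def if_not_P[OF assms(2)] using assms(1) by (intro CollectI ballI exI[of _ V]) simp
qed

text \<open>The generator is the monomial of \<open>p - m\<close>. In one direction each product in
  a local sum is tested separately; in the other a single product with the generator
  \<open>monomial (- m)\<close> of the inverse sheaf suffices.\<close>

lemma toric_sheaf_diff_iff: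
  assumes P: "has_vertices \<Sigma> P" and Q: "has_vertices \<Sigma> Q"
    and \<tau>: "\<tau> \<in> \<Sigma>" and p: "minimal_at P \<tau> p" and m: "minimal_at Q \<tau> m"
    and V: "openin (toric_variety \<Sigma>) V" "V \<subseteq> chart \<tau>" "V \<noteq> {}"
  shows "s \<in> toric_sheaf_diff \<Sigma> P Q V \<longleftrightarrow> (\<forall>x\<in>V. s * monomial (m - p) \<in> x)"
proof -
  let ?X = "toric_variety \<Sigma>"
  have rearrange: "(b * a) * monomial (m - p) = (b * monomial m) * (a * monomial (- p))" for a b
    using monomial_add[of m "- p"] by (simp add: mult_ac)
  show ?thesis
  proof
    assume s: "s \<in> toric_sheaf_diff \<Sigma> P Q V"
    show "\<forall>x\<in>V. s * monomial (m - p) \<in> x"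
    proof
      fix x assume x: "x \<in> V"
      have "\<exists>W. openin ?X W \<and> x \<in> W \<and> W \<subseteq> V \<and> (\<exists>(r::nat) a b.
          (\<forall>i<r. a i \<in> toric_sheaf \<Sigma> P W \<and> b i \<in> inverse_sheaf ?X (toric_sheaf \<Sigma> Q) W) \<and>
          s = (\<Sum>i<r. b i * a i))"
        using s x V by (simp add: toric_sheaf_diff_def tensor_sheaf_def)
      then obtain W and r :: nat and a b where W: "openin ?X W" "x \<in> W" "W \<subseteq> V"
        and ab: "\<forall>i<r. a i \<in> toric_sheaf \<Sigma> P W \<and> b i \<in> inverse_sheaf ?X (toric_sheaf \<Sigma> Q) W"
        and eq: "s = (\<Sum>i<r. b i * a i)"
        by blast
      have W': "W \<subseteq> chart \<tau>" "W \<noteq> {}" using W V by auto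
      have "(b i * monomial m) * (a i * monomial (- p)) \<in> x" if "i < r" for i
        using that ab toric_sheaf_iff[OF P \<tau> p W'] inverse_sheaf_iff[OF Q \<tau> m W(1) W'] W(2)
          chart_point_mult[of x \<tau>] W' by blast
      then have "(\<Sum>i<r. b i * a i * monomial (m - p)) \<in> x"
        unfolding rearrange using x V by (intro chart_point_sum) auto
      then show "s * monomial (m - p) \<in> x" by (simp add: eq sum_distrib_right)
    qed
  next
    assume s: "\<forall>x\<in>V. s * monomial (m - p) \<in> x"
    have "(s * monomial m) * monomial (- p) \<in> x" if "x \<in> V" for x
      using s that monomial_add[of m "- p"] by (simp add: mult.assoc)
    then have "s * monomial m \<in> toric_sheaf \<Sigma> P V"
      using toric_sheaf_iff[OF P \<tau> p V(2,3)] by blast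
    moreover have "monomial (- m) \<in> inverse_sheaf ?X (toric_sheaf \<Sigma> Q) V"
      using inverse_sheaf_iff[OF Q \<tau> m V] chart_point_one[of _ \<tau>] V(2) by (simp add: subset_eq)
    moreover have "s = monomial (- m) * (s * monomial m)"
      by (metis monomial_mult_uminus(2) mult.left_commute mult.right_neutral)
    ultimately show "s \<in> toric_sheaf_diff \<Sigma> P Q V"
      unfolding toric_sheaf_diff_def by (metis tensor_sheafI[OF V(1,3)])
  qed
qed

text \<open>Projecting the local sums gives one direction. For the converse, local sums for the two
  components need not be merged: factoring out the generator of the inverse sheaf writes
  \<open>e\<close> as one product.\<close>

lemma tensor_direct_sum_iff:
  assumes P: "has_vertices \<Sigma> P" and P': "has_vertices \<Sigma> P'" and Q: "has_vertices \<Sigma> Q"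
    and \<tau>: "\<tau> \<in> \<Sigma>" and V: "openin (toric_variety \<Sigma>) V" "V \<subseteq> chart \<tau>" "V \<noteq> {}"
  shows "e \<in> tensor_sheaf scale_pair (toric_variety \<Sigma>)
       (direct_sum (toric_sheaf \<Sigma> P) (toric_sheaf \<Sigma> P'))
       (inverse_sheaf (toric_variety \<Sigma>) (toric_sheaf \<Sigma> Q)) V
     \<longleftrightarrow> fst e \<in> toric_sheaf_diff \<Sigma> P Q V \<and> snd e \<in> toric_sheaf_diff \<Sigma> P' Q V"
    (is "e \<in> ?T \<longleftrightarrow> _")
proof
  let ?X = "toric_variety \<Sigma>"
  assume e: "e \<in> ?T"
  have "\<exists>W. openin ?X W \<and> x \<in> W \<and> W \<subseteq> V \<and>
        (\<exists>(r::nat) a b. (\<forall>i<r. a i \<in> toric_sheaf \<Sigma> P W \<and> b i \<in> inverse_sheaf ?X (toric_sheaf \<Sigma> Q) W) \<and>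
          fst e = (\<Sum>i<r. b i * a i)) \<and>
        (\<exists>(r::nat) a b. (\<forall>i<r. a i \<in> toric_sheaf \<Sigma> P' W \<and> b i \<in> inverse_sheaf ?X (toric_sheaf \<Sigma> Q) W) \<and>
          snd e = (\<Sum>i<r. b i * a i))" if x: "x \<in> V" for x
  proof -
    have "\<exists>W. openin ?X W \<and> x \<in> W \<and> W \<subseteq> V \<and> (\<exists>(r::nat) a b.
       (\<forall>i<r. a i \<in> toric_sheaf \<Sigma> P W \<times> toric_sheaf \<Sigma> P' W \<and> b i \<in> inverse_sheaf ?X (toric_sheaf \<Sigma> Q) W) \<and>
       e = (\<Sum>i<r. scale_pair (b i) (a i)))"
      using e x V unfolding tensor_sheaf_def direct_sum_def by auto
    then obtain W and r :: nat and a b where W: "openin ?X W" "x \<in> W" "W \<subseteq> V"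
      and ab: "\<forall>i<r. a i \<in> toric_sheaf \<Sigma> P W \<times> toric_sheaf \<Sigma> P' W \<and> b i \<in> inverse_sheaf ?X (toric_sheaf \<Sigma> Q) W"
      and eq: "e = (\<Sum>i<r. scale_pair (b i) (a i))"
      by blast
    have sums: "fst e = (\<Sum>i<r. b i * fst (a i))" "snd e = (\<Sum>i<r. b i * snd (a i))"
      unfolding eq by (simp_all add: fst_sum snd_sum scale_pair_def)
    have mem: "\<forall>i<r. fst (a i) \<in> toric_sheaf \<Sigma> P W \<and> b i \<in> inverse_sheaf ?X (toric_sheaf \<Sigma> Q) W"
      "\<forall>i<r. snd (a i) \<in> toric_sheaf \<Sigma> P' W \<and> b i \<in> inverse_sheaf ?X (toric_sheaf \<Sigma> Q) W"
      using ab by auto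
    show ?thesis
      by (intro exI conjI) (rule W mem sums)+
  qed
  then show "fst e \<in> toric_sheaf_diff \<Sigma> P Q V \<and> snd e \<in> toric_sheaf_diff \<Sigma> P' Q V"
    using V(3) unfolding toric_sheaf_diff_def tensor_sheaf_def
    by (simp only: if_False mem_Collect_eq) (intro conjI ballI; meson)
next
  let ?X = "toric_variety \<Sigma>"
  assume e: "fst e \<in> toric_sheaf_diff \<Sigma> P Q V \<and> snd e \<in> toric_sheaf_diff \<Sigma> P' Q V"
  obtain p p' m where m: "minimal_at P \<tau> p" "minimal_at P' \<tau> p'" "minimal_at Q \<tau> m"
    using P P' Q \<tau> unfolding has_vertices_def by blast
  have "fst e * monomial m * monomial (- p) \<in> x" "snd e * monomial m * monomial (- p') \<in> x" if "x \<in> V" for x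
    using e that monomial_add[of m "- p"] monomial_add[of m "- p'"]
      toric_sheaf_diff_iff[OF P Q \<tau> m(1,3) V] toric_sheaf_diff_iff[OF P' Q \<tau> m(2,3) V]
    by (auto simp: mult.assoc)
  then have "scale_pair (monomial m) e \<in> direct_sum (toric_sheaf \<Sigma> P) (toric_sheaf \<Sigma> P') V"
    using toric_sheaf_iff[OF P \<tau> m(1) V(2,3)] toric_sheaf_iff[OF P' \<tau> m(2) V(2,3)]
    by (simp add: scale_pair_def direct_sum_def mult.commute)
  moreover have "monomial (- m) \<in> inverse_sheaf ?X (toric_sheaf \<Sigma> Q) V"
    using inverse_sheaf_iff[OF Q \<tau> m(3) V] chart_point_one[of _ \<tau>] V(2) by (simp add: subset_eq)
  moreover have "e = scale_pair (monomial (- m)) (scale_pair (monomial m) e)"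
    by (simp add: scale_pair_def flip: mult.assoc)
  ultimately show "e \<in> ?T"
    by (metis tensor_sheafI[OF V(1,3)])
qed

section \<open>The connecting homomorphism\<close>

lemma in_cech_class_iff:
  "h \<in> cech_class k U F u \<longleftrightarrow> (\<exists>\<beta>\<in>cech_B1 k U F. h = (\<lambda>p\<in>pairs k. \<beta> p + u p))"
  by (auto simp: cech_class_def r_coset_def function_group_def)

text \<open>Cocycles that differ by a coboundary span the same coset. Closure under sums and
  negatives is assumed because \<open>F\<close> is a bare family of sets.\<close>

lemma cech_class_eq:
  fixes F :: "'p set \<Rightarrow> 'v::ab_group_add set"
  assumes add: "\<And>i a b. \<lbrakk>i \<in> {1..k}; a \<in> F (U i); b \<in> F (U i)\<rbrakk> \<Longrightarrow> a + b \<in> F (U i)"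
    and uminus: "\<And>i a. \<lbrakk>i \<in> {1..k}; a \<in> F (U i)\<rbrakk> \<Longrightarrow> - a \<in> F (U i)"
    and b: "\<And>i. i \<in> {1..k} \<Longrightarrow> b i \<in> F (U i)"
    and s: "\<And>i j. (i, j) \<in> pairs k \<Longrightarrow> s' (i, j) = s (i, j) + (b j - b i)"
  shows "cech_class k U F s' = cech_class k U F s"
proof -
  \<comment> \<open>Stated for arbitrary data because it is applied twice, with \<open>b\<close> and
    with its negative.\<close>
  have sub: "cech_class k U F u \<subseteq> cech_class k U F v"
    if d: "\<And>i. i \<in> {1..k} \<Longrightarrow> d i \<in> F (U i)"
      and u: "\<And>i j. (i, j) \<in> pairs k \<Longrightarrow> u (i, j) = v (i, j) + (d j - d i)" for d u v
  proof
    fix h assume "h \<in> cech_class k U F u"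
    then obtain \<beta> where \<beta>: "\<beta> \<in> cech_B1 k U F" and h\<beta>: "h = (\<lambda>p\<in>pairs k. \<beta> p + u p)"
      unfolding in_cech_class_iff by blast
    from \<beta> obtain a where a: "\<And>i. i \<in> {1..k} \<Longrightarrow> a i \<in> F (U i)"
      and "\<beta> = (\<lambda>(i, j) \<in> pairs k. a j - a i)"
      unfolding cech_B1_def by blast
    with h\<beta> have h: "h = (\<lambda>p\<in>pairs k. (\<lambda>(i, j) \<in> pairs k. a j - a i) p + u p)" by simp
    have "h = (\<lambda>p\<in>pairs k. (\<lambda>(i, j) \<in> pairs k. (a j + d j) - (a i + d i)) p + v p)"
      unfolding h by (rule restrict_ext) (auto simp: u)
    moreover have "(\<lambda>(i, j) \<in> pairs k. (a j + d j) - (a i + d i)) \<in> cech_B1 k U F"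
      unfolding cech_B1_def using add[OF _ a d] by (intro CollectI exI[of _ "\<lambda>i. a i + d i"]) auto
    ultimately show "h \<in> cech_class k U F v"
      unfolding in_cech_class_iff by blast
  qed
  show ?thesis
    using sub[of b s' s] sub[of "\<lambda>i. - b i" s s'] b s uminus by (intro equalityI) auto
qed

text \<open>Separates geometry from sheaf computations: \<open>crossing\<close> carries the
  consequence of convexity and disconnectedness, and \<open>generic\<close> makes intersections of
  charts nonempty, as the criteria for sections require.\<close>

locale split_difference =
  fixes \<Sigma> :: "'n::{finite,linorder} real_space set set" and P Q C0 C1 :: "'n real_space set"
  assumes vertices: "has_vertices \<Sigma> P" "has_vertices \<Sigma> Q"
      "has_vertices \<Sigma> (C0 \<union> P)" "has_vertices \<Sigma> (C1 \<union> P)"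
    and Q_eq: "Q = C0 \<union> C1 \<union> P"
    and crossing: "\<lbrakk>a \<in> C0; b \<in> C1\<rbrakk> \<Longrightarrow> \<exists>t. 0 < t \<and> t < 1 \<and> (1 - t) *\<^sub>R a + t *\<^sub>R b \<in> P"
    and generic: "\<tau> \<in> \<Sigma> \<Longrightarrow> UNIV \<in> chart \<tau>"
begin

lemma crossing':
  assumes "a \<in> C0 \<and> b \<in> C1 \<or> a \<in> C1 \<and> b \<in> C0"
  shows "\<exists>t. 0 < t \<and> t < 1 \<and> (1 - t) *\<^sub>R a + t *\<^sub>R b \<in> P"
proof (cases "a \<in> C0 \<and> b \<in> C1")
  case False
  then obtain t where "0 < t" "t < 1" "(1 - t) *\<^sub>R b + t *\<^sub>R a \<in> P"
    using crossing assms by blast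
  then show ?thesis by (intro exI[of _ "1 - t"]) (simp add: add.commute)
qed (use crossing in blast)

text \<open>
  If \<open>Q\<close> attains its minimum on \<open>\<tau>\<close> on the side of \<open>D\<close>, then a minimal point of the other side
  \<open>D' \<union> P\<close> may be replaced by a point of \<open>P\<close>: the segment between the two minimal points meets \<open>P\<close>.
\<close>

lemma minimal_other_side:
  assumes D: "D = C0 \<and> D' = C1 \<or> D = C1 \<and> D' = C0"
    and m: "minimal_at Q \<tau> m" "to_real_vec m \<in> D \<union> P"
    and m': "minimal_at (D' \<union> P) \<tau> m'" and p: "minimal_at P \<tau> p" and v: "v \<in> \<tau>"
  shows "v \<bullet> to_real_vec p \<le> v \<bullet> to_real_vec m'"
proof -
  have m'Q: "to_real_vec m' \<in> Q" and mm': "to_real_vec m' \<in> D' \<union> P"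
    using m' D by (auto simp: minimal_at_def Q_eq)
  have le: "v \<bullet> to_real_vec m \<le> v \<bullet> to_real_vec m'"
    using m m'Q v by (auto simp: minimal_at_def)
  have pmin: "y \<in> P \<Longrightarrow> v \<bullet> to_real_vec p \<le> v \<bullet> y" for y
    using p v by (auto simp: minimal_at_def)
  show ?thesis
  proof (cases "to_real_vec m \<in> P \<or> to_real_vec m' \<in> P")
    case True
    then show ?thesis using pmin[of "to_real_vec m"] pmin[of "to_real_vec m'"] le by auto
  next
    case False
    then obtain t where t: "0 < t" "t < 1"
      and "(1 - t) *\<^sub>R to_real_vec m + t *\<^sub>R to_real_vec m' \<in> P"
      using crossing'[of "to_real_vec m" "to_real_vec m'"] m mm' D by auto
    then have "v \<bullet> to_real_vec p \<le> (1 - t) * (v \<bullet> to_real_vec m) + t * (v \<bullet> to_real_vec m')"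
      using pmin by (fastforce simp: inner_simps)
    also have "\<dots> \<le> (1 - t) * (v \<bullet> to_real_vec m') + t * (v \<bullet> to_real_vec m')"
      using t le by (intro add_right_mono mult_left_mono) auto
    finally show ?thesis by (simp add: algebra_simps)
  qed
qed

lemma minimal_at_side:
  assumes "\<tau> \<in> \<Sigma>"
  obtains m D D' where "D = C0 \<and> D' = C1 \<or> D = C1 \<and> D' = C0"
    "minimal_at Q \<tau> m" "to_real_vec m \<in> D \<union> P"
proof -
  obtain m where "minimal_at Q \<tau> m" using vertices(2) assms by (auto simp: has_vertices_def)
  then show thesis using that[of C0 C1 m] that[of C1 C0 m] by (auto simp: minimal_at_def Q_eq)
qed

lemma minimal_at_union_side:
  assumes "minimal_at Q \<tau> m" "to_real_vec m \<in> D \<union> P" "D = C0 \<or> D = C1"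
  shows "minimal_at (D \<union> P) \<tau> m"
  using assms by (auto simp: minimal_at_def Q_eq)

text \<open>On the side \<open>D'\<close> away from the minimum of \<open>Q\<close>,
  \<open>minimal_other_side\<close> makes the generator a multiple of the generator of
  \<open>P\<close>. Membership for that side is what counts, but which side it is depends on
  \<tau>.\<close>

lemma stalk_Int:
  assumes \<tau>: "\<tau> \<in> \<Sigma>" "x \<in> chart \<tau>" and n: "minimal_at (C0 \<union> P) \<tau> n0" "minimal_at (C1 \<union> P) \<tau> n1"
    and p: "minimal_at P \<tau> p"
    and s: "s * monomial (- n0) \<in> x" "s * monomial (- n1) \<in> x"
  shows "s * monomial (- p) \<in> x"
proof -
  obtain m D D' where D: "D = C0 \<and> D' = C1 \<or> D = C1 \<and> D' = C0"
    and m: "minimal_at Q \<tau> m" "to_real_vec m \<in> D \<union> P"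
    using minimal_at_side[OF \<tau>(1)] .
  obtain n where n: "minimal_at (D' \<union> P) \<tau> n" and sn: "s * monomial (- n) \<in> x"
    using D n s by blast
  have "to_real_vec (n - p) \<in> dual_cone \<tau>"
    using minimal_other_side[OF D m n p] by (simp add: dual_cone_def to_real_vec_diff inner_simps)
  then have "monomial (n - p) \<in> x"
    using monomial_in_chart_ring chart_ring_subset_point[OF \<tau>(2)] by blast
  then have "s * monomial (- n) * monomial (n - p) \<in> x"
    by (rule chart_point_mult[OF \<tau>(2) sn])
  then show ?thesis by (simp add: mult.assoc flip: monomial_add)
qed

section \<open>Exactness of the sequence\<close>

lemma toric_sheaf_Int:
  assumes "s \<in> toric_sheaf \<Sigma> (C0 \<union> P) V" "s \<in> toric_sheaf \<Sigma> (C1 \<union> P) V"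
  shows "s \<in> toric_sheaf \<Sigma> P V"
proof (cases "V = {}")
  case False
  have "s \<in> toric_sheaf \<Sigma> P {x}" if x: "x \<in> V" for x
  proof -
    obtain \<tau> where \<tau>: "\<tau> \<in> \<Sigma>" "x \<in> chart \<tau>" using toric_sheaf_in_chart[OF assms(1) x] .
    obtain n0 n1 p where n: "minimal_at (C0 \<union> P) \<tau> n0" "minimal_at (C1 \<union> P) \<tau> n1"
      and p: "minimal_at P \<tau> p"
      using vertices \<tau> unfolding has_vertices_def by blast
    have "s \<in> toric_sheaf \<Sigma> (C0 \<union> P) {x}" "s \<in> toric_sheaf \<Sigma> (C1 \<union> P) {x}"
      using assms x toric_sheaf_local[OF False] by blast+
    then show ?thesis
      using toric_sheaf_iff[OF vertices(3) \<tau>(1) n(1), of "{x}"]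
        toric_sheaf_iff[OF vertices(4) \<tau>(1) n(2), of "{x}"]
        toric_sheaf_iff[OF vertices(1) \<tau>(1) p, of "{x}"] stalk_Int[OF \<tau> n p] \<tau>(2) by simp
  qed
  then show ?thesis using toric_sheaf_local[OF False] by blast
qed (use assms in \<open>simp add: toric_sheaf_def\<close>)

text \<open>The same \<open>m\<close> is minimal for \<open>Q\<close> and for
  \<open>D \<union> P\<close>, so the two sheaves share a generator on this chart.\<close>

lemma toric_sheaf_side:
  assumes \<tau>: "\<tau> \<in> \<Sigma>" and m: "minimal_at Q \<tau> m" "to_real_vec m \<in> D \<union> P"
    and D: "D = C0 \<or> D = C1" and W: "W \<subseteq> chart \<tau>" "W \<noteq> {}"
  shows "toric_sheaf \<Sigma> (D \<union> P) W = toric_sheaf \<Sigma> Q W"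
proof -
  have "has_vertices \<Sigma> (D \<union> P)" using D vertices by blast
  then show ?thesis
    using toric_sheaf_iff[OF _ \<tau> minimal_at_union_side[OF m D] W] toric_sheaf_iff[OF vertices(2) \<tau> m(1) W]
    by blast
qed

lemma short_exact:
  "short_exact_sheaves (toric_variety \<Sigma>) (\<lambda>s. (- s, s)) (\<lambda>(a, b). a + b)
     (toric_sheaf \<Sigma> P) (direct_sum (toric_sheaf \<Sigma> (C0 \<union> P)) (toric_sheaf \<Sigma> (C1 \<union> P))) (toric_sheaf \<Sigma> Q)"
  unfolding short_exact_sheaves_def
proof (intro allI impI conjI ballI)
  fix V
  have sub: "toric_sheaf \<Sigma> P V \<subseteq> toric_sheaf \<Sigma> (D \<union> P) V"
    "D = C0 \<or> D = C1 \<Longrightarrow> toric_sheaf \<Sigma> (D \<union> P) V \<subseteq> toric_sheaf \<Sigma> Q V" for D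
    by (rule toric_sheaf_mono; auto simp: Q_eq)+
  show le: "(\<lambda>s. (- s, s)) ` toric_sheaf \<Sigma> P V
      \<subseteq> direct_sum (toric_sheaf \<Sigma> (C0 \<union> P)) (toric_sheaf \<Sigma> (C1 \<union> P)) V"
    using sub(1) toric_sheaf_uminus[of _ \<Sigma> P V] by (auto simp: direct_sum_def)
  show "(\<lambda>(a, b). a + b) ` direct_sum (toric_sheaf \<Sigma> (C0 \<union> P)) (toric_sheaf \<Sigma> (C1 \<union> P)) V
      \<subseteq> toric_sheaf \<Sigma> Q V"
    using sub(2) by (auto simp: direct_sum_def intro!: toric_sheaf_add[OF vertices(2)])
  show "inj_on (\<lambda>s. (- s, s)) (toric_sheaf \<Sigma> P V)" by (simp add: inj_on_def)
  show "(\<lambda>s. (- s, s)) ` toric_sheaf \<Sigma> P V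
      = {b \<in> direct_sum (toric_sheaf \<Sigma> (C0 \<union> P)) (toric_sheaf \<Sigma> (C1 \<union> P)) V. (\<lambda>(a, b). a + b) b = 0}"
  proof (intro equalityI subsetI)
    fix b assume "b \<in> {b \<in> direct_sum (toric_sheaf \<Sigma> (C0 \<union> P)) (toric_sheaf \<Sigma> (C1 \<union> P)) V.
      (\<lambda>(a, b). a + b) b = 0}"
    then obtain a s where b: "b = (a, s)" "a + s = 0"
      and as: "a \<in> toric_sheaf \<Sigma> (C0 \<union> P) V" "s \<in> toric_sheaf \<Sigma> (C1 \<union> P) V"
      by (auto simp: direct_sum_def)
    have a: "a = - s" using b by (simp add: eq_neg_iff_add_eq_0)
    then have "s \<in> toric_sheaf \<Sigma> P V"
      using toric_sheaf_uminus[OF as(1)] as(2) by (simp add: toric_sheaf_Int)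
    then show "b \<in> (\<lambda>s. (- s, s)) ` toric_sheaf \<Sigma> P V" using b a by simp
  qed (use le in auto)
  fix c x assume V: "openin (toric_variety \<Sigma>) V" and c: "c \<in> toric_sheaf \<Sigma> Q V" and x: "x \<in> V"
  obtain \<tau> where \<tau>: "\<tau> \<in> \<Sigma>" "x \<in> chart \<tau>" using toric_sheaf_in_chart[OF c x] .
  obtain m D D' where D: "D = C0 \<and> D' = C1 \<or> D = C1 \<and> D' = C0"
    and m: "minimal_at Q \<tau> m" "to_real_vec m \<in> D \<union> P"
    using minimal_at_side[OF \<tau>(1)] .
  \<comment> \<open>Surjectivity is local: inside one chart the summand of \<open>D\<close> is all
    of O(Q), and the other component of the lift can be 0.\<close>
  define W where "W = V \<inter> chart \<tau>"
  have W: "openin (toric_variety \<Sigma>) W" "x \<in> W" "W \<subseteq> V" "W \<subseteq> chart \<tau>" "W \<noteq> {}"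
    using V x \<tau> openin_chart[OF \<tau>(1)] by (auto simp: W_def)
  have "c \<in> toric_sheaf \<Sigma> Q W"
    using c W toric_sheaf_local[of V] toric_sheaf_local[of W] by blast
  then have cD: "c \<in> toric_sheaf \<Sigma> (D \<union> P) W"
    using toric_sheaf_side[OF \<tau>(1) m _ W(4,5)] D by blast
  have "has_vertices \<Sigma> (D' \<union> P)" using D vertices by blast
  then obtain m' where "has_vertices \<Sigma> (D' \<union> P)" "minimal_at (D' \<union> P) \<tau> m'"
    using \<tau>(1) unfolding has_vertices_def by blast
  then have zD': "0 \<in> toric_sheaf \<Sigma> (D' \<union> P) W"
    using toric_sheaf_iff[OF _ \<tau>(1) _ W(4,5)] chart_point_zero[of _ \<tau>] W(4) by (simp add: subset_eq)
  have "c \<in> (\<lambda>(a, b). a + b) ` (toric_sheaf \<Sigma> (C0 \<union> P) W \<times> toric_sheaf \<Sigma> (C1 \<union> P) W)"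
  proof (cases "D = C0 \<and> D' = C1")
    case True
    then show ?thesis using cD zD' by (intro image_eqI[of _ _ "(c, 0)"]) auto
  next
    case False
    then show ?thesis using cD zD' D by (intro image_eqI[of _ _ "(0, c)"]) auto
  qed
  then show "\<exists>W. openin (toric_variety \<Sigma>) W \<and> x \<in> W \<and> W \<subseteq> V \<and>
      c \<in> (\<lambda>(a, b). a + b) ` direct_sum (toric_sheaf \<Sigma> (C0 \<union> P)) (toric_sheaf \<Sigma> (C1 \<union> P)) W"
    using W by (auto simp: direct_sum_def)
qed

section \<open>The sequence tensored with the inverse of O(Q)\<close>

abbreviation "L \<equiv> toric_sheaf_diff \<Sigma> P Q"

abbreviation "T \<equiv> tensor_sheaf scale_pair (toric_variety \<Sigma>)
  (direct_sum (toric_sheaf \<Sigma> (C0 \<union> P)) (toric_sheaf \<Sigma> (C1 \<union> P)))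
  (inverse_sheaf (toric_variety \<Sigma>) (toric_sheaf \<Sigma> Q))"

lemma
  assumes R: "has_vertices \<Sigma> R"
    and \<tau>: "\<tau> \<in> \<Sigma>" and V: "openin (toric_variety \<Sigma>) V" "V \<subseteq> chart \<tau>" "V \<noteq> {}"
  shows diff_sections_add: "\<lbrakk>a \<in> toric_sheaf_diff \<Sigma> R Q V; b \<in> toric_sheaf_diff \<Sigma> R Q V\<rbrakk>
      \<Longrightarrow> a + b \<in> toric_sheaf_diff \<Sigma> R Q V"
    and diff_sections_uminus: "a \<in> toric_sheaf_diff \<Sigma> R Q V \<Longrightarrow> - a \<in> toric_sheaf_diff \<Sigma> R Q V"
    and diff_sections_scale: "a \<in> toric_sheaf_diff \<Sigma> R Q V \<Longrightarrow> const_section c * a \<in> toric_sheaf_diff \<Sigma> R Q V"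
    and diff_sections_zero: "0 \<in> toric_sheaf_diff \<Sigma> R Q V"
proof -
  obtain r m where m: "minimal_at R \<tau> r" "minimal_at Q \<tau> m"
    using R vertices \<tau> unfolding has_vertices_def by blast
  note iff = toric_sheaf_diff_iff[OF R vertices(2) \<tau> m V]
  have x: "x \<in> V \<Longrightarrow> x \<in> chart \<tau>" for x using V by blast
  show "\<lbrakk>a \<in> toric_sheaf_diff \<Sigma> R Q V; b \<in> toric_sheaf_diff \<Sigma> R Q V\<rbrakk>
      \<Longrightarrow> a + b \<in> toric_sheaf_diff \<Sigma> R Q V"
    unfolding iff by (simp add: distrib_right chart_point_add[OF x])
  show "a \<in> toric_sheaf_diff \<Sigma> R Q V \<Longrightarrow> - a \<in> toric_sheaf_diff \<Sigma> R Q V"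
    unfolding iff by (simp add: chart_point_uminus[OF x])
  show "a \<in> toric_sheaf_diff \<Sigma> R Q V \<Longrightarrow> const_section c * a \<in> toric_sheaf_diff \<Sigma> R Q V"
    unfolding iff by (simp add: mult.assoc chart_point_mult[OF x] chart_point_const[OF x])
  show "0 \<in> toric_sheaf_diff \<Sigma> R Q V"
    unfolding iff by (simp add: chart_point_zero[OF x])
qed

text \<open>Multiplication by the generator of O(Q) reduces this to
  \<open>stalk_Int\<close>.\<close>

lemma diff_sections_Int:
  assumes \<tau>: "\<tau> \<in> \<Sigma>" and V: "openin (toric_variety \<Sigma>) V" "V \<subseteq> chart \<tau>" "V \<noteq> {}"
    and d: "d \<in> toric_sheaf_diff \<Sigma> (C0 \<union> P) Q V" "d \<in> toric_sheaf_diff \<Sigma> (C1 \<union> P) Q V"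
  shows "d \<in> L V"
proof -
  obtain n0 n1 p m where n: "minimal_at (C0 \<union> P) \<tau> n0" "minimal_at (C1 \<union> P) \<tau> n1"
    and p: "minimal_at P \<tau> p" and m: "minimal_at Q \<tau> m"
    using vertices \<tau> unfolding has_vertices_def by blast
  have shift: "d * monomial (m - q) = (d * monomial m) * monomial (- q)" for q
    using monomial_add[of m "- q"] by (simp add: mult.assoc)
  show ?thesis
    using d stalk_Int[OF \<tau> _ n p, of _ "d * monomial m"] V(2)
    unfolding toric_sheaf_diff_iff[OF vertices(3,2) \<tau> n(1) m V]
      toric_sheaf_diff_iff[OF vertices(4,2) \<tau> n(2) m V]
      toric_sheaf_diff_iff[OF vertices(1,2) \<tau> p m V] shift by blast
qed

text \<open>If the minimum of \<open>Q\<close> is attained in \<open>P\<close>, the default is 0. In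
  that case \<open>Q - (P + dual_cone \<tau>)\<close> is empty and prescribes no value.\<close>

definition side :: "'n real_space set \<Rightarrow> complex" where
  "side \<tau> = (if \<exists>m. minimal_at Q \<tau> m \<and> to_real_vec m \<in> C0 \<union> P then 0 else 1)"

lemma side_cases:
  assumes "\<tau> \<in> \<Sigma>"
  obtains m where "side \<tau> = 0" "minimal_at Q \<tau> m" "to_real_vec m \<in> C0 \<union> P"
  | m where "side \<tau> = 1" "minimal_at Q \<tau> m" "to_real_vec m \<in> C1"
proof (cases "\<exists>m. minimal_at Q \<tau> m \<and> to_real_vec m \<in> C0 \<union> P")
  case True
  then show thesis using that(1) by (auto simp: side_def)
next
  case False
  obtain m where m: "minimal_at Q \<tau> m" using vertices(2) assms by (auto simp: has_vertices_def)
  then have "to_real_vec m \<in> Q" by (simp add: minimal_at_def)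
  then have "to_real_vec m \<in> C1" using False m by (auto simp: Q_eq)
  moreover have "side \<tau> = 1" using False by (simp only: side_def if_False)
  ultimately show thesis using that(2) m by blast
qed

text \<open>Putting \<open>side\<close> into the second component makes the differences of lifts the
  wanted cocycle; the first component is then forced by the sum 1.\<close>

definition lift :: "'n real_space set \<Rightarrow> 'n function_field \<times> 'n function_field" where
  "lift \<tau> = (1 - const_section (side \<tau>), const_section (side \<tau>))"

lemma one_in_diff:
  assumes R: "has_vertices \<Sigma> R" "minimal_at R \<tau> m" "minimal_at Q \<tau> m"
    and \<tau>: "\<tau> \<in> \<Sigma>" and V: "openin (toric_variety \<Sigma>) V" "V \<subseteq> chart \<tau>" "V \<noteq> {}"
  shows "1 \<in> toric_sheaf_diff \<Sigma> R Q V"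
  using toric_sheaf_diff_iff[OF R(1) vertices(2) \<tau> R(2,3) V] chart_point_one[of _ \<tau>] V(2)
  by (simp add: subset_eq)

lemma lift_in_T:
  assumes \<tau>: "\<tau> \<in> \<Sigma>" and V: "openin (toric_variety \<Sigma>) V" "V \<subseteq> chart \<tau>" "V \<noteq> {}"
  shows "lift \<tau> \<in> T V"
  unfolding tensor_direct_sum_iff[OF vertices(3,4,2) \<tau> V]
  using \<tau>
proof (cases rule: side_cases)
  case (1 m)
  then show "fst (lift \<tau>) \<in> toric_sheaf_diff \<Sigma> (C0 \<union> P) Q V \<and> snd (lift \<tau>) \<in> toric_sheaf_diff \<Sigma> (C1 \<union> P) Q V"
    using one_in_diff[OF vertices(3) minimal_at_union_side _ \<tau> V, of m] diff_sections_zero[OF vertices(4) \<tau> V]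
    by (simp add: lift_def)
next
  case (2 m)
  then show "fst (lift \<tau>) \<in> toric_sheaf_diff \<Sigma> (C0 \<union> P) Q V \<and> snd (lift \<tau>) \<in> toric_sheaf_diff \<Sigma> (C1 \<union> P) Q V"
    using one_in_diff[OF vertices(4) minimal_at_union_side _ \<tau> V, of m] diff_sections_zero[OF vertices(3) \<tau> V]
    by (simp add: lift_def)
qed

text \<open>Two lifts of one section differ by some (-s, s), and s belongs to both sides. This
  yields both the entries of the cocycle and the independence of the lifts.\<close>

lemma kernel_in_L:
  assumes \<tau>: "\<tau> \<in> \<Sigma>" and V: "openin (toric_variety \<Sigma>) V" "V \<subseteq> chart \<tau>" "V \<noteq> {}"
    and e: "e \<in> T V" "e' \<in> T V" "fst e + snd e = fst e' + snd e'"
  shows "snd e' - snd e \<in> L V"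
proof (rule diff_sections_Int[OF \<tau> V])
  note iff = tensor_direct_sum_iff[OF vertices(3,4,2) \<tau> V]
  have "fst e - fst e' = snd e' - snd e" using e(3) by (simp add: algebra_simps)
  then show "snd e' - snd e \<in> toric_sheaf_diff \<Sigma> (C0 \<union> P) Q V"
    using e(1,2) diff_sections_add[OF vertices(3) \<tau> V, of "fst e" "- fst e'"]
      diff_sections_uminus[OF vertices(3) \<tau> V] unfolding iff by simp
  show "snd e' - snd e \<in> toric_sheaf_diff \<Sigma> (C1 \<union> P) Q V"
    using e(1,2) diff_sections_add[OF vertices(4) \<tau> V, of "snd e'" "- snd e"]
      diff_sections_uminus[OF vertices(4) \<tau> V] unfolding iff by simp
qed

text \<open>The segment from a minimal point \<open>m\<close> of \<open>Q\<close> to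
  \<open>z\<close> cannot meet \<open>P\<close>: for \<open>y\<close> on it in \<open>P\<close>,
  \<open>z - y\<close> would be a multiple of \<open>z - m\<close>, hence in the dual cone, so
  \<open>z\<close> would lie in \<open>P + dual_cone \<tau>\<close>. Thus \<open>z\<close> and
  \<open>m\<close> are on the same side.\<close>

lemma indicator_eq_side:
  assumes \<tau>: "\<tau> \<in> \<Sigma>" and z: "z \<in> Q - (P + dual_cone \<tau>)"
  shows "indicator C1 z = side \<tau>"
proof -
  have notP: "y \<notin> P" if "z - y \<in> dual_cone \<tau>" for y
  proof
    assume "y \<in> P"
    then have "y + (z - y) \<in> P + dual_cone \<tau>" using that by (intro set_plus_intro)
    then show False using z by simp
  qed
  have no_cross: False if m: "minimal_at Q \<tau> m" and c: "to_real_vec m \<in> C0 \<and> z \<in> C1 \<or> to_real_vec m \<in> C1 \<and> z \<in> C0" for m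
  proof -
    obtain t where t: "0 < t" "t < 1" "(1 - t) *\<^sub>R to_real_vec m + t *\<^sub>R z \<in> P"
      using crossing'[OF c] by blast
    have "z - to_real_vec m \<in> dual_cone \<tau>" using minimal_atD[OF m] z by simp
    then have "(1 - t) *\<^sub>R (z - to_real_vec m) \<in> dual_cone \<tau>" using t by (simp add: dual_cone_def)
    moreover have "(1 - t) *\<^sub>R (z - to_real_vec m) = z - ((1 - t) *\<^sub>R to_real_vec m + t *\<^sub>R z)"
      by (simp add: algebra_simps)
    ultimately show False using notP t by metis
  qed
  have mP: "to_real_vec m \<notin> P" if "minimal_at Q \<tau> m" for m
    using notP minimal_atD[OF that] z by blast
  have zP: "z \<notin> P" using notP[of z] by (simp add: dual_cone_zero)
  from \<tau> show ?thesis
  proof (cases rule: side_cases)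
    case (1 m)
    then show ?thesis using no_cross[of m] mP[of m] by (auto simp: indicator_def)
  next
    case (2 m)
    then show ?thesis using no_cross[of m] zP z by (auto simp: indicator_def Q_eq)
  qed
qed

text \<open>Emptiness puts the minimal point of \<open>Q\<close> into
  \<open>P + dual_cone \<tau>\<close>, so the generator quotient is regular. This absorbs the free
  constants in the comparison map.\<close>

lemma one_in_L:
  assumes \<tau>: "\<tau> \<in> \<Sigma>" and empty: "Q - (P + dual_cone \<tau>) = {}"
    and V: "openin (toric_variety \<Sigma>) V" "V \<subseteq> chart \<tau>" "V \<noteq> {}"
  shows "1 \<in> L V"
proof -
  obtain p m where p: "minimal_at P \<tau> p" and m: "minimal_at Q \<tau> m"
    using vertices \<tau> unfolding has_vertices_def by blast
  have "to_real_vec m \<in> P + dual_cone \<tau>" using m empty by (auto simp: minimal_at_def)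
  then obtain y d where "y \<in> P" "d \<in> dual_cone \<tau>" "to_real_vec m = y + d"
    by (auto simp: set_plus_def)
  then have "to_real_vec (m - p) \<in> dual_cone \<tau>"
    using dual_cone_add[OF minimal_atD[OF p], of y d] by (simp add: to_real_vec_diff algebra_simps)
  then have "\<forall>x\<in>V. monomial (m - p) \<in> x"
    using monomial_in_chart_ring chart_ring_subset_point V(2) by blast
  then show ?thesis using toric_sheaf_diff_iff[OF vertices(1,2) \<tau> p m V] by simp
qed

section \<open>One cocycle for both classes\<close>

context
  fixes k :: nat and \<sigma> :: "nat \<Rightarrow> 'n real_space set"
  assumes \<sigma>: "\<And>i. i \<in> {1..k} \<Longrightarrow> \<sigma> i \<in> \<Sigma>"
begin

abbreviation "U \<equiv> \<lambda>i. chart (\<sigma> i)"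

definition cocycle :: "nat \<times> nat \<Rightarrow> 'n function_field" where
  "cocycle = (\<lambda>(i, j) \<in> pairs k. const_section (side (\<sigma> j) - side (\<sigma> i)))"

lemma U_open_nonempty:
  assumes "i \<in> {1..k}"
  shows "openin (toric_variety \<Sigma>) (U i)" "U i \<subseteq> U i" "U i \<noteq> {}"
  using openin_chart generic \<sigma>[OF assms] by blast+

lemma cech_class_L_eq:
  assumes "\<And>i. i \<in> {1..k} \<Longrightarrow> b i \<in> L (U i)"
    and "\<And>i j. (i, j) \<in> pairs k \<Longrightarrow> s' (i, j) = s (i, j) + (b j - b i)"
  shows "cech_class k U L s' = cech_class k U L s"
  by (rule cech_class_eq[where b = b])
    (use assms diff_sections_add[OF vertices(1) \<sigma> U_open_nonempty] diff_sections_uminus[OF vertices(1) \<sigma> U_open_nonempty] in auto)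

lemma cocycle_in_Z1: "cocycle \<in> cech_Z1 k U (degree_zero L)"
proof -
  have "const_section (side (\<sigma> j) - side (\<sigma> i)) \<in> degree_zero L (U i \<inter> U j)" if ij: "(i, j) \<in> pairs k" for i j
  proof -
    have i: "\<sigma> i \<in> \<Sigma>" "\<sigma> j \<in> \<Sigma>" using ij \<sigma> by (auto simp: pairs_def)
    have W: "openin (toric_variety \<Sigma>) (U i \<inter> U j)" "U i \<inter> U j \<noteq> {}"
      using openin_chart generic i by blast+
    have "snd (lift (\<sigma> j)) - snd (lift (\<sigma> i)) \<in> L (U i \<inter> U j)"
      by (rule kernel_in_L[OF i(1) W(1) _ W(2)])
        (use lift_in_T[OF i(1) W(1) _ W(2)] lift_in_T[OF i(2) W(1) _ W(2)] in \<open>auto simp: lift_def\<close>)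
    then show ?thesis by (simp add: lift_def degree_zero_def flip: const_section_diff)
  qed
  then show ?thesis
    unfolding cech_Z1_def cocycle_def
    by (auto simp: PiE_iff pairs_def const_section_diff)
qed

text \<open>The standard lifts realise the description. For uniqueness, arbitrary lifts are compared
  with them: the differences of second components are sections of \<open>L\<close> and give a
  coboundary.\<close>

lemma connecting_hom_eq:
  "connecting_hom k U (\<lambda>s. (- s, s)) (\<lambda>(a, b). a + b) L T 1 = cech_class k U L cocycle"
  unfolding connecting_hom_def
proof (rule the_equality)
  have "cocycle \<in> cech_Z1 k U L"
    using cocycle_in_Z1 by (auto simp: cech_Z1_def degree_zero_def PiE_iff)
  moreover have "\<forall>i\<in>{1..k}. lift (\<sigma> i) \<in> T (U i) \<and> (\<lambda>(a, b). a + b) (lift (\<sigma> i)) = 1"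
    using lift_in_T[OF \<sigma> U_open_nonempty] by (auto simp: lift_def)
  moreover have "\<forall>(i, j)\<in>pairs k. (- cocycle (i, j), cocycle (i, j)) = lift (\<sigma> j) - lift (\<sigma> i)"
    by (auto simp: cocycle_def lift_def const_section_diff)
  ultimately show "\<exists>e s. (\<forall>i\<in>{1..k}. e i \<in> T (U i) \<and> (\<lambda>(a, b). a + b) (e i) = 1) \<and>
      s \<in> cech_Z1 k U L \<and> (\<forall>(i, j)\<in>pairs k. (- s (i, j), s (i, j)) = e j - e i) \<and>
      cech_class k U L cocycle = cech_class k U L s"
    by (intro exI[of _ "\<lambda>i. lift (\<sigma> i)"] exI[of _ cocycle]) blast
next
  fix h assume "\<exists>e s. (\<forall>i\<in>{1..k}. e i \<in> T (U i) \<and> (\<lambda>(a, b). a + b) (e i) = 1) \<and>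
      s \<in> cech_Z1 k U L \<and> (\<forall>(i, j)\<in>pairs k. (- s (i, j), s (i, j)) = e j - e i) \<and>
      h = cech_class k U L s"
  then obtain e s where e: "\<And>i. i \<in> {1..k} \<Longrightarrow> e i \<in> T (U i)"
      "\<And>i. i \<in> {1..k} \<Longrightarrow> (\<lambda>(a, b). a + b) (e i) = 1"
    and s: "\<forall>(i, j)\<in>pairs k. (- s (i, j), s (i, j)) = e j - e i"
    and h: "h = cech_class k U L s" by blast
  define b where "b i = snd (e i) - snd (lift (\<sigma> i))" for i
  have "b i \<in> L (U i)" if i: "i \<in> {1..k}" for i
    unfolding b_def
    by (rule kernel_in_L[OF \<sigma> U_open_nonempty])
      (use i lift_in_T[OF \<sigma> U_open_nonempty] e in \<open>auto simp: lift_def case_prod_unfold\<close>)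
  moreover have "s (i, j) = cocycle (i, j) + (b j - b i)" if "(i, j) \<in> pairs k" for i j
  proof -
    have "(- s (i, j), s (i, j)) = e j - e i" using bspec[OF s that] by simp
    from arg_cong[OF this, of snd] have "s (i, j) = snd (e j - e i)" by simp
    then show ?thesis using that by (simp add: b_def cocycle_def lift_def const_section_diff)
  qed
  ultimately show "h = cech_class k U L cocycle"
    unfolding h by (rule cech_class_L_eq)
qed

text \<open>A representative of the class is the indicator plus a constant \<open>a\<close>, which
  cancels in differences. The remaining freedom lies on charts where no value is prescribed.\<close>

lemma component_class_cech:
  "reduced_H0_to_cech_H1 \<Sigma> k \<sigma> P Q (component_class (Q - P) C1) = cech_class k U L cocycle"
  unfolding reduced_H0_to_cech_H1_def Let_def
proof (rule the_equality)
  let ?Z = "Q - P"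
  have Z: "z \<in> ?Z" if "z \<in> Q - (P + dual_cone \<tau>)" for z and \<tau> :: "'n real_space set"
    using that set_plus_intro[of z P 0 "dual_cone \<tau>"] dual_cone_zero[of \<tau>] by auto
  have cc: "f \<in> component_class ?Z C1 \<longleftrightarrow> (\<exists>a. f = (\<lambda>z\<in>?Z. a + indicator C1 z))" for f
    by (auto simp: component_class_def r_coset_def function_group_def constant_functions_def
        fun_eq_iff restrict_def)
  have "(\<lambda>z\<in>?Z. 0 + indicator C1 z) \<in> component_class ?Z C1"
    unfolding cc by blast
  moreover have "\<forall>i\<in>{1..k}. \<forall>z\<in>Q - (P + dual_cone (\<sigma> i)). (\<lambda>z\<in>?Z. 0 + indicator C1 z) z = side (\<sigma> i)"
  proof (intro ballI)
    fix i z assume "i \<in> {1..k}" and z: "z \<in> Q - (P + dual_cone (\<sigma> i))"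
    then show "(\<lambda>z\<in>?Z. 0 + indicator C1 z) z = side (\<sigma> i)"
      using Z[OF z] indicator_eq_side[OF \<sigma>] by simp
  qed
  ultimately show "\<exists>f\<in>component_class ?Z C1. \<exists>c s.
      (\<forall>i\<in>{1..k}. \<forall>z\<in>Q - (P + dual_cone (\<sigma> i)). f z = c i) \<and>
      s = (\<lambda>(i, j)\<in>pairs k. const_section (c j - c i)) \<and>
      s \<in> cech_Z1 k U (degree_zero L) \<and> cech_class k U L cocycle = cech_class k U L s"
    using cocycle_in_Z1
    by (intro bexI[rotated, of "\<lambda>z\<in>?Z. 0 + indicator C1 z"] exI[of _ "\<lambda>i. side (\<sigma> i)"] exI[of _ cocycle])
      (auto simp: cocycle_def)
  fix h assume "\<exists>f\<in>component_class ?Z C1. \<exists>c s.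
      (\<forall>i\<in>{1..k}. \<forall>z\<in>Q - (P + dual_cone (\<sigma> i)). f z = c i) \<and>
      s = (\<lambda>(i, j)\<in>pairs k. const_section (c j - c i)) \<and>
      s \<in> cech_Z1 k U (degree_zero L) \<and> h = cech_class k U L s"
  then obtain f c where f: "f \<in> component_class ?Z C1"
    and fc: "\<forall>i\<in>{1..k}. \<forall>z\<in>Q - (P + dual_cone (\<sigma> i)). f z = c i"
    and h: "h = cech_class k U L (\<lambda>(i, j)\<in>pairs k. const_section (c j - c i))"
    by blast
  obtain a where "f = (\<lambda>z\<in>?Z. a + indicator C1 z)" using f cc by blast
  with fc have c: "\<And>i z. \<lbrakk>i \<in> {1..k}; z \<in> Q - (P + dual_cone (\<sigma> i))\<rbrakk>
        \<Longrightarrow> (\<lambda>z\<in>?Z. a + indicator C1 z) z = c i"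
    by blast
  \<comment> \<open>The deviation from the shifted standard value: it vanishes where
    \<open>c i\<close> is prescribed, and elsewhere \<open>one_in_L\<close> makes it a section. The
    factor 1 matches the form of \<open>diff_sections_scale\<close>.\<close>
  define b :: "nat \<Rightarrow> 'n function_field" where "b i = const_section (c i - side (\<sigma> i) - a) * 1" for i
  have "b i \<in> L (U i)" if i: "i \<in> {1..k}" for i
  proof (cases "Q - (P + dual_cone (\<sigma> i)) = {}")
    case True
    show ?thesis
      unfolding b_def
      by (rule diff_sections_scale[OF vertices(1) \<sigma>[OF i] U_open_nonempty[OF i]
            one_in_L[OF \<sigma>[OF i] True U_open_nonempty[OF i]]])
  next
    case False
    then obtain z where "z \<in> Q - (P + dual_cone (\<sigma> i))" by blast
    then have "c i = a + side (\<sigma> i)" using c[OF i] Z indicator_eq_side[OF \<sigma>[OF i]] by fastforce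
    then show ?thesis using diff_sections_zero[OF vertices(1) \<sigma> U_open_nonempty] i by (simp add: b_def)
  qed
  then show "h = cech_class k U L cocycle"
    unfolding h by (rule cech_class_L_eq) (simp_all add: b_def cocycle_def const_section_diff)
qed

end

end

section \<open>Reduced cohomology\<close>

context
  fixes Z :: "'a::topological_space set"
begin

abbreviation "LC \<equiv> function_group (locally_constant_functions Z) Z"

lemma locally_constant_functionsI:
  assumes "f \<in> extensional Z"
    "\<And>z. z \<in> Z \<Longrightarrow> \<exists>W. openin (top_of_set Z) W \<and> z \<in> W \<and> f constant_on W"
  shows "f \<in> locally_constant_functions Z"
  using assms by (auto simp: locally_constant_functions_def)

lemma constant_functions_subset: "constant_functions Z \<subseteq> locally_constant_functions Z"
proof
  fix f assume "f \<in> constant_functions Z"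
  then obtain c where f: "f = (\<lambda>z\<in>Z. c)" by (auto simp: constant_functions_def)
  then have "f constant_on Z" by (auto simp: constant_on_def)
  then show "f \<in> locally_constant_functions Z"
    using f by (intro locally_constant_functionsI) (auto intro!: exI[of _ Z])
qed

text \<open>Covers both group operations: \<open>h\<close> is addition for products, and for
  inverses a negation that ignores its second argument.\<close>

lemma locally_constant_compose2:
  assumes f: "f \<in> locally_constant_functions Z" and g: "g \<in> locally_constant_functions Z"
  shows "(\<lambda>z\<in>Z. h (f z) (g z)) \<in> locally_constant_functions Z"
proof (rule locally_constant_functionsI)
  fix z assume z: "z \<in> Z"
  obtain W W' where W: "openin (top_of_set Z) W" "z \<in> W" "f constant_on W"
    and W': "openin (top_of_set Z) W'" "z \<in> W'" "g constant_on W'"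
    using f g z unfolding locally_constant_functions_def by blast
  have "W \<subseteq> Z" using openin_subset[OF W(1)] by simp
  then have "(\<lambda>z\<in>Z. h (f z) (g z)) constant_on W \<inter> W'"
    using W(3) W'(3) unfolding constant_on_def by (metis IntD1 IntD2 restrict_apply' subsetD)
  then show "\<exists>W. openin (top_of_set Z) W \<and> z \<in> W \<and> (\<lambda>z\<in>Z. h (f z) (g z)) constant_on W"
    using W W' by (intro exI[of _ "W \<inter> W'"]) auto
qed simp

lemma comm_group_LC: "comm_group LC"
proof (rule comm_groupI)
  fix x y z assume "x \<in> carrier LC" "y \<in> carrier LC" "z \<in> carrier LC"
  then have lc: "x \<in> locally_constant_functions Z" "y \<in> locally_constant_functions Z"
    by (auto simp: function_group_def)
  show "x \<otimes>\<^bsub>LC\<^esub> y \<in> carrier LC"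
    using locally_constant_compose2[OF lc, of "(+)"] by (simp add: function_group_def)
  show "x \<otimes>\<^bsub>LC\<^esub> y \<otimes>\<^bsub>LC\<^esub> z = x \<otimes>\<^bsub>LC\<^esub> (y \<otimes>\<^bsub>LC\<^esub> z)" "x \<otimes>\<^bsub>LC\<^esub> y = y \<otimes>\<^bsub>LC\<^esub> x"
    by (auto simp: function_group_def fun_eq_iff add_ac)
  have ext: "x \<in> extensional Z" using lc by (simp add: locally_constant_functions_def)
  show "\<one>\<^bsub>LC\<^esub> \<otimes>\<^bsub>LC\<^esub> x = x"
    using ext by (auto simp: function_group_def fun_eq_iff extensional_def)
  show "\<exists>y\<in>carrier LC. y \<otimes>\<^bsub>LC\<^esub> x = \<one>\<^bsub>LC\<^esub>"
    using locally_constant_compose2[OF lc(1,1), of "\<lambda>a _. - a"]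
    by (intro bexI[of _ "\<lambda>z\<in>Z. - x z"]) (auto simp: function_group_def fun_eq_iff)
next
  have "(\<lambda>z\<in>Z. 0) \<in> locally_constant_functions Z"
    using constant_functions_subset by (auto simp: constant_functions_def)
  then show "\<one>\<^bsub>LC\<^esub> \<in> carrier LC" by (simp add: function_group_def)
qed

lemma normal_constants: "constant_functions Z \<lhd> LC"
proof -
  interpret comm_group LC by (rule comm_group_LC)
  have "subgroup (constant_functions Z) LC"
  proof (rule subgroupI)
    show "constant_functions Z \<subseteq> carrier LC"
      using constant_functions_subset by (simp add: function_group_def)
    show "constant_functions Z \<noteq> {}" by (simp add: constant_functions_def)
    fix a assume a: "a \<in> constant_functions Z"
    then obtain c where c: "a = (\<lambda>z\<in>Z. c)" by (auto simp: constant_functions_def)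
    have mem: "(\<lambda>z\<in>Z. - c) \<in> constant_functions Z" by (auto simp: constant_functions_def)
    have "inv\<^bsub>LC\<^esub> a = (\<lambda>z\<in>Z. - c)"
    proof (rule inv_equality)
      show "(\<lambda>z\<in>Z. - c) \<otimes>\<^bsub>LC\<^esub> a = \<one>\<^bsub>LC\<^esub>"
        unfolding c by (auto simp: function_group_def)
    qed (use a mem constant_functions_subset in \<open>auto simp: function_group_def\<close>)
    then show "inv\<^bsub>LC\<^esub> a \<in> constant_functions Z" using mem by simp
    fix b assume "b \<in> constant_functions Z"
    then obtain d where d: "b = (\<lambda>z\<in>Z. d)" by (auto simp: constant_functions_def)
    have "a \<otimes>\<^bsub>LC\<^esub> b = (\<lambda>z\<in>Z. c + d)" unfolding c d by (auto simp: function_group_def)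
    then show "a \<otimes>\<^bsub>LC\<^esub> b \<in> constant_functions Z" by (auto simp: constant_functions_def)
  qed
  then show ?thesis by (rule normal_iff_subgroup[THEN iffD2])
qed

lemma indicator_locally_constant:
  assumes "openin (top_of_set Z) C" "openin (top_of_set Z) (Z - C)"
  shows "(\<lambda>z\<in>Z. indicator C z) \<in> locally_constant_functions Z"
proof (rule locally_constant_functionsI)
  fix z assume z: "z \<in> Z"
  have "(\<lambda>z\<in>Z. indicator C z) constant_on C" "(\<lambda>z\<in>Z. indicator C z) constant_on Z - C"
    using openin_subset[OF assms(1)]
    by (auto simp: constant_on_def subset_eq intro: exI[of _ 1] exI[of _ 0])
  then show "\<exists>W. openin (top_of_set Z) W \<and> z \<in> W \<and> (\<lambda>z\<in>Z. indicator C z) constant_on W"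
    using z assms by (cases "z \<in> C") blast+
qed simp

text \<open>The two indicators add up to the constant 1, which is trivial in the quotient.\<close>

lemma component_class_complement:
  assumes C: "openin (top_of_set Z) C" "openin (top_of_set Z) D" and D: "D = Z - C"
  shows "component_class Z D = inv\<^bsub>reduced_H0 Z\<^esub> component_class Z C"
proof -
  interpret N: normal "constant_functions Z" LC by (rule normal_constants)
  interpret R: group "reduced_H0 Z" unfolding reduced_H0_def by (rule N.factorgroup_is_group)
  let ?c = "\<lambda>z\<in>Z. indicator C z" and ?d = "\<lambda>z\<in>Z. indicator D z"
  have "Z - D = C" using openin_subset[OF C(1)] D by auto
  then have lc: "?c \<in> carrier LC" "?d \<in> carrier LC"
    using indicator_locally_constant C D by (auto simp: function_group_def)
  have one: "?d \<otimes>\<^bsub>LC\<^esub> ?c = (\<lambda>z\<in>Z. 1)"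
    by (auto simp: function_group_def fun_eq_iff D indicator_def)
  have "component_class Z D \<otimes>\<^bsub>reduced_H0 Z\<^esub> component_class Z C
      = constant_functions Z #>\<^bsub>LC\<^esub> (?d \<otimes>\<^bsub>LC\<^esub> ?c)"
    unfolding reduced_H0_def component_class_def using N.rcos_sum[OF lc(2,1)] by (simp add: FactGroup_def)
  also have "\<dots> = \<one>\<^bsub>reduced_H0 Z\<^esub>"
    unfolding one reduced_H0_def
    using N.rcos_const[of "\<lambda>z\<in>Z. 1"] by (simp add: FactGroup_def constant_functions_def)
  finally show ?thesis
    using lc by (intro R.inv_equality[symmetric])
      (auto simp: reduced_H0_def FactGroup_def component_class_def RCOSETS_def)
qed

end

text \<open>Components are closed in \<open>Z\<close>; when there are just two, each is the
  complement of the other and therefore also open. This makes the indicators locally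
  constant.\<close>

lemma two_components_complement:
  assumes "components Z = {C, D}" "C \<noteq> D"
  shows "D = Z - C" "openin (top_of_set Z) D"
proof -
  have "C \<inter> D = {}" using assms components_nonoverlap[of C Z D] by blast
  moreover have "C \<union> D = Z" using Union_components[of Z] assms by simp
  ultimately show eq: "D = Z - C" by blast
  have "closedin (top_of_set Z) C" using closedin_component[of C Z] assms by simp
  then show "openin (top_of_set Z) D" unfolding eq by (simp add: closedin_def)
qed

text \<open>A segment in \<open>Q\<close> that avoids \<open>P\<close> is a connected subset of
  \<open>Q - P\<close> and stays in one component. The crossing parameter is strictly between 0 and
  1 because the endpoints lie outside \<open>P\<close>.\<close>

lemma segment_crosses:
  fixes P Q :: "'a::euclidean_space set"
  assumes C: "components (Q - P) = {C, D}" "C \<noteq> D" and Q: "convex Q" and ab: "a \<in> C" "b \<in> D"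
  shows "\<exists>t. 0 < t \<and> t < 1 \<and> (1 - t) *\<^sub>R a + t *\<^sub>R b \<in> P"
proof -
  have abQ: "a \<in> Q - P" "b \<in> Q - P" "b \<notin> C"
    using two_components_complement[OF C] ab in_components_subset[of C "Q - P"] C(1) by auto
  have "closed_segment a b \<inter> P \<noteq> {}"
  proof
    assume "closed_segment a b \<inter> P = {}"
    moreover have "closed_segment a b \<subseteq> Q" using Q abQ by (simp add: closed_segment_subset)
    ultimately have "closed_segment a b \<subseteq> C"
      using components_maximal[of C "Q - P" "closed_segment a b"] C(1) ab(1) by blast
    then show False using abQ by auto
  qed
  then obtain t where t: "0 \<le> t" "t \<le> 1" "(1 - t) *\<^sub>R a + t *\<^sub>R b \<in> P"
    by (auto simp: in_segment)
  moreover have "t \<noteq> 0" "t \<noteq> 1" using t(3) abQ by auto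
  ultimately show ?thesis by (intro exI[of _ t]) auto
qed

theorem theorem15:
  fixes \<Delta> \<Delta>p \<Delta>m C0 C1 :: "'n::{finite,linorder} real_space set"
    and \<Sigma> :: "'n real_space set set"
    and k :: nat and \<sigma> :: "nat \<Rightarrow> 'n real_space set"
  assumes "lattice_polyhedron \<Delta>" and "aff_dim \<Delta> = int CARD('n)"
    and "\<Sigma> = normal_fan \<Delta>"
    and "bij_betw \<sigma> {1..k} (maximal_cones \<Sigma>)"
    and "lattice_polyhedron \<Delta>p" and "\<Delta>p \<in> Pol_plus \<Sigma>"
    and "lattice_polyhedron \<Delta>m" and "\<Delta>m \<in> Pol_plus \<Sigma>"
    and "\<Delta>p \<subseteq> \<Delta>m"
    and "components (\<Delta>m - \<Delta>p) = {C0, C1}" and "C0 \<noteq> C1"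
    and "C0 \<union> \<Delta>p \<in> Pol_plus \<Sigma>" and "C1 \<union> \<Delta>p \<in> Pol_plus \<Sigma>"
  shows
    "let X = toric_variety \<Sigma>;
         U = (\<lambda>i. chart (\<sigma> i));
         L = toric_sheaf_diff \<Sigma> \<Delta>p \<Delta>m;
         E = direct_sum (toric_sheaf \<Sigma> (C0 \<union> \<Delta>p)) (toric_sheaf \<Sigma> (C1 \<union> \<Delta>p));
         f = (\<lambda>s. (- s, s));
         g = (\<lambda>(a, b). a + b);
         Z = \<Delta>m - \<Delta>p
     in equivariant_sheaf X torus_act (toric_sheaf \<Sigma> \<Delta>p) \<and>
        equivariant_sheaf X torus_act_pair E \<and>
        equivariant_sheaf X torus_act (toric_sheaf \<Sigma> \<Delta>m) \<and>
        equivariant_map torus_act torus_act_pair f \<and>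
        equivariant_map torus_act_pair torus_act g \<and>
        short_exact_sheaves X f g (toric_sheaf \<Sigma> \<Delta>p) E (toric_sheaf \<Sigma> \<Delta>m) \<and>
        extension_class \<Sigma> k \<sigma> f g \<Delta>p E \<Delta>m \<in> cech_H1_degree_zero k U L \<and>
        extension_class \<Sigma> k \<sigma> f g \<Delta>p E \<Delta>m
          = reduced_H0_to_cech_H1 \<Sigma> k \<sigma> \<Delta>p \<Delta>m (component_class Z C1) \<and>
        component_class Z C1 = inv\<^bsub>reduced_H0 Z\<^esub> (component_class Z C0)"
proof -
  have ne: "\<Delta>p \<noteq> {}" "\<Delta>m \<noteq> {}"
    using assms(5,7) by (auto simp: lattice_polyhedron_def extreme_point_of_def)
  note comp = assms(10,11)
  have comp': "components (\<Delta>m - \<Delta>p) = {C1, C0}" "C1 \<noteq> C0" using comp by auto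
  have C: "C0 \<union> C1 = \<Delta>m - \<Delta>p" using Union_components[of "\<Delta>m - \<Delta>p"] comp by simp
  have convex: "convex \<Delta>" "convex \<Delta>m"
    using assms(1,7) by (auto simp: lattice_polyhedron_def polyhedron_imp_convex)
  interpret split_difference \<Sigma> \<Delta>p \<Delta>m C0 C1
  proof
    show "has_vertices \<Sigma> \<Delta>p" "has_vertices \<Sigma> \<Delta>m" "has_vertices \<Sigma> (C0 \<union> \<Delta>p)" "has_vertices \<Sigma> (C1 \<union> \<Delta>p)"
      using Pol_plus_has_vertices[of _ \<Delta>] assms(3,6,8,12,13) ne by auto
    show "\<Delta>m = C0 \<union> C1 \<union> \<Delta>p" using C assms(9) by auto
    show "\<exists>t. 0 < t \<and> t < 1 \<and> (1 - t) *\<^sub>R a + t *\<^sub>R b \<in> \<Delta>p" if "a \<in> C0" "b \<in> C1" for a b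
      by (rule segment_crosses[OF comp convex(2) that])
    show "UNIV \<in> chart \<tau>" if "\<tau> \<in> \<Sigma>" for \<tau>
      using generic_point_in_chart dual_normal_cone_interior[OF _ convex(1) assms(2)] that assms(3) by blast
  qed
  have \<sigma>: "\<sigma> i \<in> \<Sigma>" if "i \<in> {1..k}" for i
    using bij_betwE[OF assms(4)] that by (auto simp: maximal_cones_def)
  have ext: "extension_class \<Sigma> k \<sigma> (\<lambda>s. (- s, s)) (\<lambda>(a, b). a + b) \<Delta>p
      (direct_sum (toric_sheaf \<Sigma> (C0 \<union> \<Delta>p)) (toric_sheaf \<Sigma> (C1 \<union> \<Delta>p))) \<Delta>m
    = cech_class k (\<lambda>i. chart (\<sigma> i)) (toric_sheaf_diff \<Sigma> \<Delta>p \<Delta>m) (cocycle k \<sigma>)"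
    unfolding extension_class_def by (rule connecting_hom_eq[OF \<sigma>])
  have red: "reduced_H0_to_cech_H1 \<Sigma> k \<sigma> \<Delta>p \<Delta>m (component_class (\<Delta>m - \<Delta>p) C1)
    = cech_class k (\<lambda>i. chart (\<sigma> i)) (toric_sheaf_diff \<Sigma> \<Delta>p \<Delta>m) (cocycle k \<sigma>)"
    by (rule component_class_cech[OF \<sigma>])
  have "cech_class k (\<lambda>i. chart (\<sigma> i)) (toric_sheaf_diff \<Sigma> \<Delta>p \<Delta>m) (cocycle k \<sigma>)
      \<in> cech_H1_degree_zero k (\<lambda>i. chart (\<sigma> i)) (toric_sheaf_diff \<Sigma> \<Delta>p \<Delta>m)"
    unfolding cech_H1_degree_zero_def by (intro imageI cocycle_in_Z1[OF \<sigma>])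
  moreover have "component_class (\<Delta>m - \<Delta>p) C1 = inv\<^bsub>reduced_H0 (\<Delta>m - \<Delta>p)\<^esub> component_class (\<Delta>m - \<Delta>p) C0"
    using component_class_complement two_components_complement[OF comp] two_components_complement[OF comp'] by blast
  ultimately show ?thesis
    unfolding Let_def ext red
    by (intro conjI equivariant_toric_sheaf equivariant_direct_sum equivariant_antidiagonal
        equivariant_pair_add short_exact refl)
qed

end
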